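(* Let $f_1,\ldots,f_r\in k[x_1,\ldots,x_n]$ ($r\ge 1$) be algebraically independent over $k$, and set $\omega=df_1\wedge\cdots\wedge df_r$. Then the inequality $$\deg_{\mathbf w}\Phi(g)\ \ge\ \deg_{\mathbf w}^g\Phi+m_{\mathbf w}^g(\Phi)\,\bigl(\deg_{\mathbf w}(\omega\wedge dg)-\deg_{\mathbf w}\omega-\deg_{\mathbf w}g\bigr)$$ holds for each $\Phi\in k[f_1,\ldots,f_r][y]\setminus\{0\}$, each $g\in k[x_1,\ldots,x_n]\setminus\{0\}$ and each $\mathbf w\in\Gamma^n$.
   Context: $k$ is a field of characteristic zero, $k[\mathbf x]=k[x_1,\ldots,x_n]$ is the polynomial ring in $n\ge1$ variables, and $\Gamma$ is a totally ordered additive group (abelian, with order compatible with addition). For $\mathbf w=(w_1,\ldots,w_n)\in\Gamma^n$, the $\mathbf w$-weighted grading $k[\mathbf x]=\bigoplus_{\gamma\in\Gamma}k[\mathbf x]_\gamma$ is given by letting $k[\mathbf x]_\gamma$ be the $k$-span of the monomials $x_1^{a_1}\cdots x_n^{a_n}$ with $\sum_i a_iw_i=\gamma$. For $f=\sum_\gamma f_\gamma\neq0$ with $f_\gamma\in k[\mathbf x]_\gamma$, $\deg_{\mathbf w}f$ is the maximum of the $\gamma$ with $f_\gamma\ne0$; $\deg_{\mathbf w}0=-\infty$, a symbol less than every element of $\Gamma$. Conventions: $(-\infty)+\gamma=\gamma+(-\infty)=-\infty$ for $\gamma\in\Gamma\cup\{-\infty\}$, and $l\gamma$ denotes the sum of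 $l$ copies of $\gamma$ for $l\in\mathbb Z_{\ge0}$ and $\gamma\in\Gamma\cup\{-\infty\}$ (so $0\cdot(-\infty)=0$ and $l(-\infty)=-\infty$ for $l\ge1$). For a polynomial $\Phi=\sum_i\phi_iy^i\in k[\mathbf x][y]$ in a variable $y$ (with $\phi_i\in k[\mathbf x]$) and $g\in k[\mathbf x]$, put $\Phi(g)=\sum_i\phi_ig^i$ and $\deg_{\mathbf w}^g\Phi=\max\{\deg_{\mathbf w}(\phi_ig^i)\mid i\in\mathbb Z_{\ge0}\}$. Let $\partial_y^i\Phi$ be the $i$-th derivative of $\Phi$ in $y$, and $$m_{\mathbf w}^g(\Phi)=\min\{i\in\mathbb Z_{\ge0}\mid \deg_{\mathbf w}^g\partial_y^i\Phi=\deg_{\mathbf w}\bigl((\partial_y^i\Phi)(g)\bigr)\}.$$ $\Omega_{k[\mathbf x]/k}$ is the module of differentials and $df$ the differential of $f\in k[\mathbf x]$. For $\eta\in\bigwedge^s\Omega_{k[\mathbf x]/k}$, written uniquely as $\eta=\sum_{1\le i_1<\cdots<i_s\le n}h_{i_1,\ldots,i_s}dx_{i_1}\wedge\cdots\wedge dx_{i_s}$ with coefficients in $k[\mathbf x]$, put $\deg_{\mathbf w}\eta=\max\{\deg_{\mathbf w}(h_{i_1,\ldots,i_s})+w_{i_1}+\cdots+w_{i_s}\}$, the maximum over $1\le i_1<\cdots<i_s\le n$; the zero form has degree $-\infty$. *)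

theory Defs
  imports
    "HOL-Library.Poly_Mapping"
    "HOL-Library.Extended"
    "HOL-Computational_Algebra.Polynomial"
begin

section \<open>Polynomials in several variables\<close>

text \<open>
  For a finite linearly ordered type \<open>'n\<close> with \<open>n\<close> elements, \<open>('n, 'k) mpoly\<close> is
  \<open>k[x\<^sub>1, \<dots>, x\<^sub>n]\<close>: a finitely supported family of coefficients indexed by exponent
  vectors. Types are nonempty, so \<open>n \<ge> 1\<close>. With \<open>'n = nat\<close> the same type is used for
  polynomials in auxiliary variables \<open>t\<^sub>1, t\<^sub>2, \<dots>\<close>.
\<close>

type_synonym ('n, 'k) mpoly = "('n \<Rightarrow>\<^sub>0 nat) \<Rightarrow>\<^sub>0 'k"

definition const :: "'k::zero \<Rightarrow> ('n, 'k) mpoly" where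
  "const c = Poly_Mapping.single 0 c"

definition vars :: "('i, 'k::zero) mpoly \<Rightarrow> 'i set" where
  "vars P = (\<Union>m\<in>Poly_Mapping.keys P. Poly_Mapping.keys m)"

definition subst :: "('i \<Rightarrow> ('n, 'k) mpoly) \<Rightarrow> ('i, 'k::comm_ring_1) mpoly \<Rightarrow> ('n, 'k) mpoly" where
  "subst f P = (\<Sum>m\<in>Poly_Mapping.keys P. const (Poly_Mapping.lookup P m) *
                 (\<Prod>i\<in>Poly_Mapping.keys m. f i ^ Poly_Mapping.lookup m i))"

definition alg_independent :: "(nat \<Rightarrow> ('n, 'k::comm_ring_1) mpoly) \<Rightarrow> nat \<Rightarrow> bool" where
  "alg_independent f r \<longleftrightarrow>
     (\<forall>P. vars P \<subseteq> {1..r} \<longrightarrow> subst f P = 0 \<longrightarrow> P = 0)"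

text \<open>\<open>gen_subalgebra f r\<close> is \<open>k[f\<^sub>1, \<dots>, f\<^sub>r]\<close>.\<close>

definition gen_subalgebra :: "(nat \<Rightarrow> ('n, 'k::comm_ring_1) mpoly) \<Rightarrow> nat \<Rightarrow> ('n, 'k) mpoly set" where
  "gen_subalgebra f r = {subst f P | P. vars P \<subseteq> {1..r}}"

definition partial :: "'n \<Rightarrow> ('n, 'k::comm_ring_1) mpoly \<Rightarrow> ('n, 'k) mpoly" where
  "partial i f = (\<Sum>m\<in>Poly_Mapping.keys f.
     Poly_Mapping.single (m - Poly_Mapping.single i 1)
       (of_nat (Poly_Mapping.lookup m i) * Poly_Mapping.lookup f m))"


section \<open>Weighted degree\<close>

text \<open>
  Degrees live in \<open>\<Gamma> \<union> {-\<infinity>}\<close>, embedded in \<^typ>\<open>'g extended\<close>. The extra element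
  \<^term>\<open>Pinf\<close> is never a degree. The library operations satisfy
  \<open>-\<infinity> + \<gamma> = \<gamma> + -\<infinity> = -\<infinity>\<close> for \<open>\<gamma> \<in> \<Gamma> \<union> {-\<infinity>}\<close>, and \<open>-\<infinity> - \<gamma> = -\<infinity>\<close> for
  \<open>\<gamma> \<in> \<Gamma>\<close>.
\<close>

definition nmult :: "nat \<Rightarrow> 'a::comm_monoid_add \<Rightarrow> 'a" where
  "nmult l \<gamma> = (\<Sum>j<l. \<gamma>)"

definition weight :: "('n::finite \<Rightarrow> 'g::comm_monoid_add) \<Rightarrow> ('n \<Rightarrow>\<^sub>0 nat) \<Rightarrow> 'g" where
  "weight w m = (\<Sum>i\<in>UNIV. nmult (Poly_Mapping.lookup m i) (w i))"

definition homog_component ::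
  "('n::finite \<Rightarrow> 'g::comm_monoid_add) \<Rightarrow> 'g \<Rightarrow> ('n, 'k::comm_ring_1) mpoly \<Rightarrow> ('n, 'k) mpoly" where
  "homog_component w \<gamma> f = (\<Sum>m\<in>{m \<in> Poly_Mapping.keys f. weight w m = \<gamma>}.
     Poly_Mapping.single m (Poly_Mapping.lookup f m))"

definition wdeg ::
  "('n::finite \<Rightarrow> 'g::linordered_ab_group_add) \<Rightarrow> ('n, 'k::comm_ring_1) mpoly \<Rightarrow> 'g extended" where
  "wdeg w f = (if f = 0 then Minf else Fin (Max {\<gamma>. homog_component w \<gamma> f \<noteq> 0}))"

text \<open>
  In the next two definitions \<open>\<Phi>\<close> is a univariate polynomial in \<open>y\<close> over \<open>k[x\<^sub>1, \<dots>, x\<^sub>n]\<close>.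
  The range is a finite set, since all but finitely many coefficients of \<open>\<Phi>\<close> vanish.
\<close>

definition wdeg_at ::
  "('n::finite \<Rightarrow> 'g::linordered_ab_group_add) \<Rightarrow> ('n, 'k::comm_ring_1) mpoly \<Rightarrow>
     ('n, 'k) mpoly poly \<Rightarrow> 'g extended" where
  "wdeg_at w g \<Phi> = Max (range (\<lambda>i. wdeg w (coeff \<Phi> i * g ^ i)))"

definition m_mult ::
  "('n::{finite,linorder} \<Rightarrow> 'g::linordered_ab_group_add) \<Rightarrow> ('n, 'k::idom) mpoly \<Rightarrow>
     ('n, 'k) mpoly poly \<Rightarrow> nat" where
  "m_mult w g \<Phi> =
     (LEAST i. wdeg_at w g ((pderiv ^^ i) \<Phi>) = wdeg w (poly ((pderiv ^^ i) \<Phi>) g))"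


section \<open>Differential forms\<close>

text \<open>
  The module of differentials of \<open>k[x\<^sub>1, \<dots>, x\<^sub>n]\<close> is free on \<open>dx\<^sub>1, \<dots>, dx\<^sub>n\<close>, so its exterior
  algebra is free on the products \<open>dx\<^sub>I = dx\<^bsub>i\<^sub>1\<^esub> \<and> \<dots> \<and> dx\<^bsub>i\<^sub>s\<^esub>\<close> for
  \<open>I = {i\<^sub>1 < \<dots> < i\<^sub>s}\<close>. A form is the family of its coefficients \<open>h\<^sub>I\<close>; an \<open>s\<close>-form vanishes at
  every \<open>I\<close> with \<open>card I \<noteq> s\<close>.
\<close>

type_synonym ('n, 'k) form = "'n set \<Rightarrow> ('n, 'k) mpoly"

text \<open>
  For disjoint \<open>I\<close> and \<open>J\<close> one has \<open>dx\<^sub>I \<and> dx\<^sub>J = (-1)\<^sup>e dx\<^bsub>I \<union> J\<^esub>\<close>, where \<open>e\<close> is the number of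
  pairs \<open>(i, j) \<in> I \<times> J\<close> with \<open>j < i\<close>; otherwise the product is zero.
\<close>

definition wedge ::
  "('n::{finite,linorder}, 'k::comm_ring_1) form \<Rightarrow> ('n, 'k) form \<Rightarrow> ('n, 'k) form"
    (infixr \<open>\<and>\<^sub>F\<close> 70) where
  "(\<alpha> \<and>\<^sub>F \<beta>) K = (\<Sum>I\<in>Pow K.
     (- 1) ^ card {(i, j). i \<in> I \<and> j \<in> K - I \<and> j < i} * \<alpha> I * \<beta> (K - I))"

definition one_form :: "('n, 'k::comm_ring_1) form" where
  "one_form I = (if I = {} then 1 else 0)"

definition differential :: "('n, 'k::comm_ring_1) mpoly \<Rightarrow> ('n, 'k) form" where
  "differential f I = (if card I = 1 then partial (the_elem I) f else 0)"

text \<open>\<open>wedge_differentials f r\<close> is \<open>df\<^sub>1 \<and> \<dots> \<and> df\<^sub>r\<close>.\<close>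

definition wedge_differentials ::
  "(nat \<Rightarrow> ('n::{finite,linorder}, 'k::comm_ring_1) mpoly) \<Rightarrow> nat \<Rightarrow> ('n, 'k) form" where
  "wedge_differentials f r = foldr (\<and>\<^sub>F) (map (\<lambda>i. differential (f i)) [1..<Suc r]) one_form"

text \<open>
  For an \<open>s\<close>-form the index sets of the wrong cardinality only contribute \<open>-\<infinity>\<close> to the maximum.
\<close>

definition form_wdeg ::
  "('n::finite \<Rightarrow> 'g::linordered_ab_group_add) \<Rightarrow> ('n, 'k::comm_ring_1) form \<Rightarrow> 'g extended" where
  "form_wdeg w \<eta> = Max (range (\<lambda>I. wdeg w (\<eta> I) + Fin (\<Sum>i\<in>I. w i)))"

end

theory Submission
  imports Defs "HOL-Library.FuncSet"
begin

text \<open>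
  Two facts drive the inequality. First, \<open>\<omega> \<and> dp = 0\<close> for every \<open>p\<close> in \<open>k[f\<^sub>1, \<dots>, f\<^sub>r]\<close>
  (\<open>wedge_differential_gen_subalgebra\<close>), so after multiplication by \<open>\<omega>\<close> the coefficients of \<open>\<Phi>\<close>
  behave like constants: \<open>\<omega> \<and> d(\<Phi>(g)) = \<Phi>'(g) (\<omega> \<and> dg)\<close> (\<open>wedge_differential_poly\<close>). Secondly,
  a derivative by \<open>x\<^sub>i\<close> lowers degrees by at least \<open>w\<^sub>i\<close>, hence \<open>deg (\<omega> \<and> dp) \<le> deg \<omega> + deg p\<close>
  (\<open>form_wdeg_wedge_differential_le\<close>). With \<open>p = \<Phi>(g)\<close>, and since degrees are additive on products,
  these give
  \<open>deg \<Phi>(g) \<ge> deg \<Phi>'(g) + (deg (\<omega> \<and> dg) - deg \<omega>)\<close>.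
  This applies to all derivatives of \<open>\<Phi>\<close>; iterating \<open>m = m_mult w g \<Phi>\<close> times leads to the degree of
  \<open>\<Phi>\<^sup>(\<^sup>m\<^sup>)(g)\<close>, which by the choice of \<open>m\<close> equals \<open>wdeg_at w g \<Phi>\<^sup>(\<^sup>m\<^sup>)\<close>.

  It remains to compare \<open>wdeg_at w g \<Phi>\<^sup>(\<^sup>m\<^sup>)\<close> with \<open>wdeg_at w g \<Phi>\<close>. As long as the degree of
  \<open>\<Psi>(g)\<close> is smaller than \<open>wdeg_at w g \<Psi>\<close>, the terms \<open>\<psi>\<^sub>i g\<^sup>i\<close> of top degree cancel, so at least one
  of them has \<open>i \<ge> 1\<close> and survives differentiation: the derivative has a value of \<open>wdeg_at w g\<close>
  that is smaller by exactly \<open>deg g\<close> (\<open>wdeg_at_pderiv\<close>). By minimality of \<open>m\<close> this happens \<open>m\<close> times.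

  The subtraction of \<open>deg \<omega>\<close> makes sense only if \<open>\<omega> \<noteq> 0\<close>, which is the Jacobian criterion in
  characteristic zero (\<open>wedge_differentials_nonzero\<close>). It is obtained by exchange: starting from
  \<open>dx\<^sub>1 \<and> \<dots> \<and> dx\<^sub>n \<noteq> 0\<close>, the forms \<open>df\<^sub>1, df\<^sub>2, \<dots>\<close> replace one \<open>dx\<^sub>j\<close> each while the product
  stays nonzero. When \<open>df\<^sub>1 \<and> \<dots> \<and> df\<^sub>k \<and> dx\<^sub>J \<noteq> 0\<close> with \<open>k + card J = n\<close>, the \<open>n + 1\<close> polynomials
  \<open>f\<^sub>1, \<dots>, f\<^bsub>k+1\<^esub>, x\<^sub>j\<close> (\<open>j \<in> J\<close>) satisfy a relation by a dimension count
  (\<open>dependent_if_more_than_variables\<close>). A relation of least degree involves some \<open>x\<^sub>j\<close>, as the \<open>f\<^sub>i\<close>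
  are independent, and its partial derivative there does not vanish at the given polynomials
  (\<open>minimal_relation\<close>). Differentiating the relation yields a linear dependence of the differentials
  in which \<open>dx\<^sub>j\<close> has a nonzero coefficient, so \<open>dx\<^sub>j\<close> can be exchanged for \<open>df\<^bsub>k+1\<^esub>\<close>
  (\<open>wedge_exchange\<close>).
\<close>

section \<open>Polynomials and their partial derivatives\<close>

lemma sum_monomials:
  fixes f :: "('i, 'k::comm_monoid_add) mpoly"
  shows "f = (\<Sum>m\<in>Poly_Mapping.keys f. Poly_Mapping.single m (Poly_Mapping.lookup f m))"
  by (rule poly_mapping_eqI)
     (auto simp: lookup_sum lookup_single when_def sum.delta in_keys_iff)

lemma mpoly_induct [case_names single add]:
  fixes f :: "('i, 'k::comm_monoid_add) mpoly"
  assumes single: "\<And>m c. P (Poly_Mapping.single m c)"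
    and add: "\<And>f g. P f \<Longrightarrow> P g \<Longrightarrow> P (f + g)"
  shows "P f"
proof -
  have "P (\<Sum>m\<in>S. Poly_Mapping.single m (Poly_Mapping.lookup f m))" if "finite S" for S
    using that
  proof induction
    case empty
    show ?case using single[of 0 0] by simp
  next
    case (insert m S)
    then show ?case using single add by simp
  qed
  then show ?thesis by (subst sum_monomials) simp
qed

lemma lookup_partial:
  "Poly_Mapping.lookup (partial i f) m =
     of_nat (Poly_Mapping.lookup m i + 1) * Poly_Mapping.lookup f (m + Poly_Mapping.single i 1)"
proof -
  let ?e = "Poly_Mapping.single i (1::nat)"
  have eq: "(of_nat (Poly_Mapping.lookup m' i) * Poly_Mapping.lookup f m' when m' - ?e = m) =
      (if m' = m + ?e then of_nat (Poly_Mapping.lookup m i + 1) * Poly_Mapping.lookup f (m + ?e) else 0)"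
    for m'
  proof (cases "m' = m + ?e")
    case True
    then show ?thesis by (simp add: lookup_add)
  next
    case False
    have "Poly_Mapping.lookup m' i = 0" if "m' - ?e = m"
    proof (rule ccontr)
      assume "Poly_Mapping.lookup m' i \<noteq> 0"
      then have "m' - ?e + ?e = m'"
        by (intro poly_mapping_eqI) (auto simp: lookup_add lookup_minus lookup_single when_def)
      with that False show False by simp
    qed
    with False show ?thesis by (auto simp: when_def)
  qed
  \<comment> \<open>Truncated subtraction makes \<open>m' - e\<^sub>i = m\<close> also possible for \<open>m' = m\<close>; the factor
    \<open>m' i = 0\<close> discards this case.\<close>
  show ?thesis
    unfolding partial_def lookup_sum lookup_single eq
    by (auto simp: sum.delta in_keys_iff)
qed

lemma partial_add: "partial i (f + g) = partial i f + partial i g"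
  by (rule poly_mapping_eqI) (simp add: lookup_partial lookup_add algebra_simps)

lemma partial_single:
  "partial i (Poly_Mapping.single m c) =
     Poly_Mapping.single (m - Poly_Mapping.single i 1) (of_nat (Poly_Mapping.lookup m i) * c)"
  by (cases "c = 0") (simp_all add: partial_def)

lemma partial_zero [simp]: "partial i 0 = 0"
  by (simp add: partial_def)

lemma partial_sum: "partial i (sum f A) = (\<Sum>a\<in>A. partial i (f a))"
  by (induction A rule: infinite_finite_induct) (simp_all add: partial_add)

lemma partial_const [simp]: "partial i (const c) = 0"
  by (simp add: const_def partial_single)

lemma partial_one [simp]: "partial i 1 = 0"
  by (metis partial_const const_def single_one)

lemma partial_mult:
  fixes f g :: "('n, 'k::comm_ring_1) mpoly"
  shows "partial i (f * g) = partial i f * g + f * partial i g"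
proof -
  let ?e = "Poly_Mapping.single i (1::nat)"
  \<comment> \<open>If \<open>m i = 0\<close>, truncated subtraction can make the two monomials differ, but then the
    coefficient is zero.\<close>
  have shift: "Poly_Mapping.single (m - ?e + m') (of_nat (Poly_Mapping.lookup m i) * c) =
      Poly_Mapping.single (m + m' - ?e) (of_nat (Poly_Mapping.lookup m i) * c)" for m m' :: "'n \<Rightarrow>\<^sub>0 nat" and c :: 'k
  proof (cases "Poly_Mapping.lookup m i = 0")
    case False
    then have "m - ?e + m' = m + m' - ?e"
      by (intro poly_mapping_eqI) (auto simp: lookup_add lookup_minus lookup_single when_def)
    then show ?thesis by simp
  qed simp
  have mono: "partial i (Poly_Mapping.single m c * Poly_Mapping.single m' c') =
      partial i (Poly_Mapping.single m c) * Poly_Mapping.single m' c' +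
      Poly_Mapping.single m c * partial i (Poly_Mapping.single m' c')"
    for m m' :: "'n \<Rightarrow>\<^sub>0 nat" and c c' :: 'k
    using shift[of m m' "c * c'"] shift[of m' m "c * c'"]
    by (simp add: mult_single partial_single lookup_add algebra_simps flip: single_add)
  show ?thesis
  proof (induction f rule: mpoly_induct)
    case (single m c)
    show ?case
      by (induction g rule: mpoly_induct) (simp_all add: mono partial_add algebra_simps)
  qed (simp add: partial_add algebra_simps)
qed

lemma partial_power:
  "partial i (f ^ a) = of_nat a * f ^ (a - 1) * partial i f"
proof (induction a)
  case (Suc a)
  then show ?case by (cases a) (simp_all add: partial_mult algebra_simps)
qed simp

lemma partial_prod:
  assumes "finite A"
  shows "partial i (\<Prod>a\<in>A. f a) = (\<Sum>a\<in>A. partial i (f a) * (\<Prod>b\<in>A - {a}. f b))"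
  using assms
proof (induction A)
  case (insert x A)
  have "(\<Prod>b\<in>insert x A - {a}. f b) = f x * (\<Prod>b\<in>A - {a}. f b)" if "a \<in> A" for a
  proof -
    have "insert x A - {a} = insert x (A - {a})" using that insert by auto
    then show ?thesis using insert by simp
  qed
  then have "(\<Sum>a\<in>A. partial i (f a) * (\<Prod>b\<in>insert x A - {a}. f b)) =
      f x * (\<Sum>a\<in>A. partial i (f a) * (\<Prod>b\<in>A - {a}. f b))"
    by (simp add: sum_distrib_left algebra_simps)
  then show ?case using insert by (simp add: partial_mult)
qed simp

text \<open>
  The definition of \<open>subst\<close> ranges over the monomials that occur in \<open>P\<close>. Fixed larger index sets
  allow different polynomials to be compared term by term.
\<close>

lemma subst_eq:
  assumes "finite S" "Poly_Mapping.keys P \<subseteq> S" "finite A" "vars P \<subseteq> A"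
  shows "subst h P = (\<Sum>m\<in>S. const (Poly_Mapping.lookup P m) *
                         (\<Prod>i\<in>A. h i ^ Poly_Mapping.lookup m i))"
proof -
  have "(\<Prod>i\<in>Poly_Mapping.keys m. h i ^ Poly_Mapping.lookup m i) =
      (\<Prod>i\<in>A. h i ^ Poly_Mapping.lookup m i)" if "m \<in> Poly_Mapping.keys P" for m
  proof (rule prod.mono_neutral_left)
    show "Poly_Mapping.keys m \<subseteq> A" using that assms(4) unfolding vars_def by blast
  qed (use assms in \<open>auto simp: in_keys_iff\<close>)
  then show ?thesis
    unfolding subst_def using assms(1,2)
    by (intro sum.mono_neutral_cong_left) (auto simp: in_keys_iff const_def)
qed

lemma vars_partial: "vars (partial i P) \<subseteq> vars P"
proof
  fix j assume "j \<in> vars (partial i P)"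
  then obtain m where m: "Poly_Mapping.lookup (partial i P) m \<noteq> 0" "Poly_Mapping.lookup m j \<noteq> 0"
    by (auto simp: vars_def in_keys_iff)
  from m(1) have "Poly_Mapping.lookup P (m + Poly_Mapping.single i 1) \<noteq> 0"
    unfolding lookup_partial by auto
  moreover have "Poly_Mapping.lookup (m + Poly_Mapping.single i 1) j \<noteq> 0"
    using m(2) by (simp add: lookup_add)
  ultimately show "j \<in> vars P"
    unfolding vars_def by (auto simp: in_keys_iff)
qed

lemma finite_vars: "finite (vars P)"
  by (simp add: vars_def)

lemma subst_add: "subst h (P + Q) = subst h P + subst h Q"
proof -
  let ?S = "Poly_Mapping.keys P \<union> Poly_Mapping.keys Q" and ?A = "vars P \<union> vars Q"
  have "vars (P + Q) \<subseteq> ?A" "Poly_Mapping.keys (P + Q) \<subseteq> ?S"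
    using keys_add[of P Q] by (auto simp: vars_def)
  then show ?thesis
    by (simp add: subst_eq[of ?S _ ?A] finite_vars lookup_add const_def single_add algebra_simps sum.distrib)
qed

lemma subst_zero [simp]: "subst h 0 = 0"
  by (simp add: subst_def)

lemma subst_single:
  assumes "finite A" "Poly_Mapping.keys m \<subseteq> A"
  shows "subst h (Poly_Mapping.single m c) = const c * (\<Prod>i\<in>A. h i ^ Poly_Mapping.lookup m i)"
proof -
  have "vars (Poly_Mapping.single m c) \<subseteq> A" using assms by (simp add: vars_def)
  then show ?thesis using subst_eq[of "{m}" "Poly_Mapping.single m c" A h] assms by simp
qed

lemma const_mult: "const (a * b) = const a * const b"
  by (simp add: const_def mult_single)

lemma const_of_nat: "const (of_nat a) = of_nat a"
  by (simp add: const_def)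

lemma subst_sum: "subst h (sum P S) = (\<Sum>s\<in>S. subst h (P s))"
  by (induction S rule: infinite_finite_induct) (simp_all add: subst_add)

text \<open>
  The chain rule. Both sides are additive in \<open>P\<close>, so it suffices to treat monomials.
\<close>

lemma partial_subst:
  fixes P :: "('i, 'k::comm_ring_1) mpoly"
  assumes "finite A" "vars P \<subseteq> A"
  shows "partial j (subst h P) = (\<Sum>i\<in>A. subst h (partial i P) * partial j (h i))"
proof -
  have mono: "partial j (subst h (Poly_Mapping.single m c)) =
      (\<Sum>i\<in>A. subst h (partial i (Poly_Mapping.single m c)) * partial j (h i))"
    if "Poly_Mapping.keys m \<subseteq> A" for m and c :: 'k
  proof -
    have "subst h (partial i (Poly_Mapping.single m c)) * partial j (h i) =
       const c * (partial j (h i ^ Poly_Mapping.lookup m i) *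
         (\<Prod>b\<in>A - {i}. h b ^ Poly_Mapping.lookup m b))" if i: "i \<in> A" for i
    proof -
      let ?m' = "m - Poly_Mapping.single i 1"
      have "Poly_Mapping.keys ?m' \<subseteq> Poly_Mapping.keys m"
        by (auto simp: in_keys_iff lookup_minus lookup_single when_def)
      then have "Poly_Mapping.keys ?m' \<subseteq> A" using that \<open>Poly_Mapping.keys m \<subseteq> A\<close> by auto
      moreover have "(\<Prod>b\<in>A. h b ^ Poly_Mapping.lookup ?m' b) =
          h i ^ (Poly_Mapping.lookup m i - 1) * (\<Prod>b\<in>A - {i}. h b ^ Poly_Mapping.lookup m b)"
        unfolding prod.remove[OF assms(1) i]
        by (intro arg_cong2[where f="(*)"] prod.cong) (auto simp: lookup_minus lookup_single when_def)
      ultimately show ?thesis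
        by (simp add: partial_single subst_single[OF assms(1)] partial_power const_mult
            const_of_nat algebra_simps)
    qed
    then show ?thesis
      by (simp add: subst_single[OF assms(1) that] partial_mult partial_prod[OF assms(1)]
          sum_distrib_left)
  qed
  have "partial j (subst h P) =
      (\<Sum>m\<in>Poly_Mapping.keys P. partial j (subst h (Poly_Mapping.single m (Poly_Mapping.lookup P m))))"
    by (subst sum_monomials) (simp add: subst_sum partial_sum)
  also have "\<dots> = (\<Sum>m\<in>Poly_Mapping.keys P. \<Sum>i\<in>A.
      subst h (partial i (Poly_Mapping.single m (Poly_Mapping.lookup P m))) * partial j (h i))"
    using assms(2) by (intro sum.cong refl mono) (auto simp: vars_def)
  also have "\<dots> = (\<Sum>i\<in>A. subst h (partial i P) * partial j (h i))"
    by (subst (3) sum_monomials)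
       (simp add: subst_sum partial_sum sum_distrib_right sum.swap[of _ A])
  finally show ?thesis .
qed


section \<open>Weighted degrees\<close>

lemma lookup_homog_component:
  "Poly_Mapping.lookup (homog_component w \<gamma> f) m =
     (if weight w m = \<gamma> then Poly_Mapping.lookup f m else 0)"
  by (auto simp: homog_component_def lookup_sum lookup_single when_def sum.delta in_keys_iff)

lemma homog_component_nonzero_iff:
  "homog_component w \<gamma> f \<noteq> 0 \<longleftrightarrow> \<gamma> \<in> weight w ` Poly_Mapping.keys f"
  by (auto simp: poly_mapping_eq_iff fun_eq_iff lookup_homog_component in_keys_iff)

lemma wdeg_eq_Max:
  assumes "f \<noteq> 0"
  shows "wdeg w f = Fin (Max (weight w ` Poly_Mapping.keys f))"
  using assms by (simp add: wdeg_def homog_component_nonzero_iff)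

lemma keys_nonempty: "f \<noteq> 0 \<Longrightarrow> Poly_Mapping.keys f \<noteq> {}"
  by (metis empty_iff in_keys_iff lookup_zero poly_mapping_eqI)

lemma wdeg_zero [simp]: "wdeg w 0 = Minf"
  by (simp add: wdeg_def)

lemma wdeg_eq_Minf_iff [simp]: "wdeg w f = Minf \<longleftrightarrow> f = 0"
  by (simp add: wdeg_def)

lemma wdeg_neq_Pinf [simp]: "wdeg w f \<noteq> Pinf"
  by (simp add: wdeg_def)

lemma wdeg_le_iff:
  "wdeg w f \<le> Fin \<gamma> \<longleftrightarrow> (\<forall>m\<in>Poly_Mapping.keys f. weight w m \<le> \<gamma>)"
proof (cases "f = 0")
  case False
  then show ?thesis using keys_nonempty[OF False]
    by (simp add: wdeg_eq_Max)
qed simp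

lemma wdeg_add_le:
  assumes "wdeg w f \<le> x" "wdeg w g \<le> x"
  shows "wdeg w (f + g) \<le> x"
proof (cases x)
  case (Fin \<gamma>)
  then show ?thesis using assms keys_add[of f g] by (auto simp: wdeg_le_iff)
qed (use assms in auto)

lemma wdeg_sum_le:
  assumes "\<And>a. a \<in> A \<Longrightarrow> wdeg w (f a) \<le> x"
  shows "wdeg w (sum f A) \<le> x"
  using assms by (induction A rule: infinite_finite_induct) (auto intro: wdeg_add_le)

lemma nmult_add: "nmult (a + b) \<gamma> = nmult a \<gamma> + nmult b \<gamma>"
  by (induction b) (simp_all add: nmult_def ac_simps)

lemma nmult_0 [simp]: "nmult 0 \<gamma> = 0"
  and nmult_Suc: "nmult (Suc a) \<gamma> = nmult a \<gamma> + \<gamma>"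
  by (simp_all add: nmult_def)

lemma weight_add: "weight w (m + m') = weight w m + weight w m'"
  by (simp add: weight_def lookup_add nmult_add sum.distrib)

lemma weight_single: "weight w (Poly_Mapping.single i 1) = w i"
proof -
  have "nmult (Poly_Mapping.lookup (Poly_Mapping.single i 1) j) (w j) = (if j = i then w i else 0)" for j
    by (simp add: lookup_single nmult_def when_def)
  then show ?thesis by (simp add: weight_def)
qed

lemma wdeg_obtain_top:
  fixes f :: "('n::finite, 'k::comm_ring_1) mpoly"
  assumes "wdeg w f = Fin \<gamma>"
  obtains f1 f2 where "f = f1 + f2" "f1 \<noteq> 0"
    "\<And>m. m \<in> Poly_Mapping.keys f1 \<Longrightarrow> weight w m = \<gamma>"
    "\<And>m. m \<in> Poly_Mapping.keys f2 \<Longrightarrow> weight w m < \<gamma>"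
proof -
  have nz: "f \<noteq> 0" using assms by auto
  then have g: "\<gamma> = Max (weight w ` Poly_Mapping.keys f)" using assms by (simp add: wdeg_eq_Max)
  have le: "weight w m \<le> \<gamma>" if "m \<in> Poly_Mapping.keys f" for m
    using that g by simp
  let ?f1 = "homog_component w \<gamma> f"
  show thesis
  proof (rule that[of ?f1 "f - ?f1"])
    show "?f1 \<noteq> 0"
      unfolding homog_component_nonzero_iff g using keys_nonempty[OF nz] by (intro Max_in) auto
  next
    fix m assume "m \<in> Poly_Mapping.keys ?f1"
    then show "weight w m = \<gamma>" by (simp add: in_keys_iff lookup_homog_component split: if_splits)
  next
    fix m assume "m \<in> Poly_Mapping.keys (f - ?f1)"
    then have "weight w m \<noteq> \<gamma>" "m \<in> Poly_Mapping.keys f"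
      by (auto simp: in_keys_iff lookup_minus lookup_homog_component split: if_splits)
    then show "weight w m < \<gamma>" using le[of m] by simp
  qed simp
qed

text \<open>
  Degrees add because the product of the two top homogeneous parts is nonzero and homogeneous
  of degree \<open>\<gamma> + \<delta>\<close>, and the remaining products only have monomials of smaller weight.
\<close>

lemma wdeg_mult:
  fixes f g :: "('n::{finite,linorder}, 'k::idom) mpoly"
  shows "wdeg w (f * g) = wdeg w f + wdeg w g"
proof (cases "f = 0 \<or> g = 0")
  case True
  then show ?thesis by (cases "wdeg w f"; cases "wdeg w g") auto
next
  case False
  then obtain \<gamma> \<delta> where gd: "wdeg w f = Fin \<gamma>" "wdeg w g = Fin \<delta>"
    by (meson wdeg_eq_Max)
  have "weight w m \<le> \<gamma> + \<delta>" if m: "m \<in> Poly_Mapping.keys (f * g)" for m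
  proof -
    obtain a b where "m = a + b" "a \<in> Poly_Mapping.keys f" "b \<in> Poly_Mapping.keys g"
      using keys_mult[of f g] m by blast
    moreover have "\<forall>m\<in>Poly_Mapping.keys f. weight w m \<le> \<gamma>" "\<forall>m\<in>Poly_Mapping.keys g. weight w m \<le> \<delta>"
      using gd by (simp_all flip: wdeg_le_iff)
    ultimately show ?thesis by (simp add: weight_add add_mono)
  qed
  then have "wdeg w (f * g) \<le> Fin (\<gamma> + \<delta>)" by (simp add: wdeg_le_iff)
  moreover have "Fin (\<gamma> + \<delta>) \<le> wdeg w (f * g)"
  proof -
    obtain f1 f2 where f: "f = f1 + f2" "f1 \<noteq> 0" "\<And>m. m \<in> Poly_Mapping.keys f1 \<Longrightarrow> weight w m = \<gamma>"
      "\<And>m. m \<in> Poly_Mapping.keys f2 \<Longrightarrow> weight w m < \<gamma>" using wdeg_obtain_top[OF gd(1)] by metis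
    obtain g1 g2 where g: "g = g1 + g2" "g1 \<noteq> 0" "\<And>m. m \<in> Poly_Mapping.keys g1 \<Longrightarrow> weight w m = \<delta>"
      "\<And>m. m \<in> Poly_Mapping.keys g2 \<Longrightarrow> weight w m < \<delta>" using wdeg_obtain_top[OF gd(2)] by metis
    have "f1 * g1 \<noteq> 0" using f g by simp
    then obtain m where m: "m \<in> Poly_Mapping.keys (f1 * g1)" using keys_nonempty by blast
    then have wm: "weight w m = \<gamma> + \<delta>"
      using keys_mult[of f1 g1] f(3) g(3) by (fastforce simp: weight_add)
    have "m \<notin> Poly_Mapping.keys (f1 * g2)"
      using keys_mult[of f1 g2] f(3) g(4) wm by (fastforce simp: weight_add)
    moreover have "m \<notin> Poly_Mapping.keys (f2 * g)"
    proof
      assume "m \<in> Poly_Mapping.keys (f2 * g)"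
      then obtain a b where ab: "m = a + b" "a \<in> Poly_Mapping.keys f2" "b \<in> Poly_Mapping.keys g"
        using keys_mult[of f2 g] by blast
      have "\<forall>m\<in>Poly_Mapping.keys g. weight w m \<le> \<delta>" using gd(2) by (simp flip: wdeg_le_iff)
      then have "weight w a + weight w b < \<gamma> + \<delta>"
        using f(4)[OF ab(2)] ab(3) by (intro add_less_le_mono) auto
      then show False using wm ab(1) by (simp add: weight_add)
    qed
    moreover have "f * g = f1 * g1 + f1 * g2 + f2 * g"
      unfolding f(1) g(1) by (simp add: algebra_simps)
    ultimately have mk: "m \<in> Poly_Mapping.keys (f * g)"
      using m by (auto simp: in_keys_iff lookup_add)
    then have "f * g \<noteq> 0" by auto
    with mk have "weight w m \<le> Max (weight w ` Poly_Mapping.keys (f * g))" by simp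
    then show ?thesis using wm \<open>f * g \<noteq> 0\<close> by (simp add: wdeg_eq_Max)
  qed
  ultimately show ?thesis using gd by simp
qed

lemma wdeg_partial_le:
  fixes f :: "('n::finite, 'k::comm_ring_1) mpoly"
  shows "wdeg w (partial i f) + Fin (w i) \<le> wdeg w f"
proof (cases "wdeg w f")
  case (Fin \<gamma>)
  have "weight w m \<le> \<gamma> - w i" if m: "m \<in> Poly_Mapping.keys (partial i f)" for m
  proof -
    have "m + Poly_Mapping.single i 1 \<in> Poly_Mapping.keys f"
      using m by (auto simp: in_keys_iff lookup_partial)
    moreover have "\<forall>m\<in>Poly_Mapping.keys f. weight w m \<le> \<gamma>"
      using Fin by (simp flip: wdeg_le_iff)
    ultimately have "weight w (m + Poly_Mapping.single i 1) \<le> \<gamma>" by blast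
    then show ?thesis unfolding weight_add weight_single by (simp add: algebra_simps)
  qed
  then have "wdeg w (partial i f) \<le> Fin (\<gamma> - w i)" by (simp add: wdeg_le_iff)
  then show ?thesis using Fin by (cases "wdeg w (partial i f)") (auto simp: algebra_simps)
qed auto

section \<open>Exterior multiplication by one-forms\<close>

definition is_one_form :: "('n, 'k::zero) form \<Rightarrow> bool" where
  "is_one_form \<alpha> \<longleftrightarrow> (\<forall>I. card I \<noteq> 1 \<longrightarrow> \<alpha> I = 0)"

lemma is_one_form_differential: "is_one_form (differential f)"
  by (simp add: is_one_form_def differential_def)

lemma differential_singleton [simp]: "differential f {i} = partial i f"
  by (simp add: differential_def)

text \<open>
  The sign of \<open>dx\<^sub>i \<and> dx\<^bsub>K - {i}\<^esub> = \<plusminus> dx\<^sub>K\<close> for \<open>i \<in> K\<close>.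
\<close>

definition wsign :: "'n::linorder set \<Rightarrow> 'n \<Rightarrow> 'a::comm_ring_1" where
  "wsign K i = (-1) ^ card {j \<in> K. j < i}"

lemma wsign_remove:
  assumes "finite K" "i \<in> K"
  shows "wsign (K - {i}) j = (if i < j then - wsign K j else wsign K j)"
proof (cases "i < j")
  case True
  have "{l \<in> K. l < j} = insert i {l \<in> K - {i}. l < j}" using True assms by auto
  moreover have "finite {l \<in> K - {i}. l < j}" using assms by simp
  ultimately have "card {l \<in> K. l < j} = Suc (card {l \<in> K - {i}. l < j})" by simp
  then show ?thesis using True by (simp add: wsign_def)
next
  case False
  then have "{l \<in> K - {i}. l < j} = {l \<in> K. l < j}" by auto
  then show ?thesis using False by (simp add: wsign_def)
qed

lemma wedge_one_form_left:
  fixes \<alpha> :: "('n::{finite,linorder}, 'k::comm_ring_1) form"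
  assumes "is_one_form \<alpha>"
  shows "(\<alpha> \<and>\<^sub>F \<eta>) K = (\<Sum>i\<in>K. wsign K i * \<alpha> {i} * \<eta> (K - {i}))"
proof -
  have card: "card {(i', j). i' \<in> {i} \<and> j \<in> K - {i} \<and> j < i'} = card {j \<in> K. j < i}" for i
  proof -
    have "{(i', j). i' \<in> {i} \<and> j \<in> K - {i} \<and> j < i'} = Pair i ` {j \<in> K. j < i}" by auto
    then show ?thesis by (simp add: card_image inj_on_def)
  qed
  have "(\<alpha> \<and>\<^sub>F \<eta>) K = (\<Sum>I\<in>(\<lambda>i. {i}) ` K.
     (- 1) ^ card {(i, j). i \<in> I \<and> j \<in> K - I \<and> j < i} * \<alpha> I * \<eta> (K - I))"
    unfolding wedge_def
  proof (rule sum.mono_neutral_right)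
    show "\<forall>I\<in>Pow K - (\<lambda>i. {i}) ` K.
      (- 1) ^ card {(i, j). i \<in> I \<and> j \<in> K - I \<and> j < i} * \<alpha> I * \<eta> (K - I) = 0"
    proof
      fix I assume I: "I \<in> Pow K - (\<lambda>i. {i}) ` K"
      then have "card I \<noteq> 1" by (auto simp: card_1_singleton_iff)
      then show "(- 1) ^ card {(i, j). i \<in> I \<and> j \<in> K - I \<and> j < i} * \<alpha> I * \<eta> (K - I) = 0"
        using assms by (simp add: is_one_form_def)
    qed
  qed auto
  also have "\<dots> = (\<Sum>i\<in>K. wsign K i * \<alpha> {i} * \<eta> (K - {i}))"
    unfolding wsign_def by (subst sum.reindex) (simp_all only: card o_def inj_on_def, simp)
  finally show ?thesis .
qed

text \<open>
  A factor on the right can be moved to the left up to a sign that depends only on the index set.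
  All further computations can thus use multiplication from the left.
\<close>

lemma wedge_one_form_right:
  fixes \<alpha> :: "('n::{finite,linorder}, 'k::comm_ring_1) form"
  assumes "is_one_form \<alpha>"
  shows "(\<eta> \<and>\<^sub>F \<alpha>) K = (-1) ^ (card K - 1) * (\<alpha> \<and>\<^sub>F \<eta>) K"
proof -
  have sign: "(-1) ^ card {(i', j). i' \<in> K - {i} \<and> j \<in> {i} \<and> j < i'} =
      (-1) ^ (card K - 1) * (wsign K i :: ('n, 'k) mpoly)" if i: "i \<in> K" for i
  proof -
    have "{(i', j). i' \<in> K - {i} \<and> j \<in> {i} \<and> j < i'} = (\<lambda>j. (j, i)) ` {j \<in> K. i < j}"
      using i by auto
    then have c: "card {(i', j). i' \<in> K - {i} \<and> j \<in> {i} \<and> j < i'} = card {j \<in> K. i < j}"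
      by (simp add: card_image inj_on_def)
    have split: "K - {i} = {j \<in> K. i < j} \<union> {j \<in> K. j < i}" by auto
    have "card (K - {i}) = card {j \<in> K. i < j} + card {j \<in> K. j < i}"
      unfolding split by (rule card_Un_disjoint) auto
    then have "card K - 1 = card {j \<in> K. i < j} + card {j \<in> K. j < i}"
      using i by simp
    then show ?thesis unfolding c wsign_def by (simp add: power_add mult.assoc flip: power_mult_distrib)
  qed
  have "(\<eta> \<and>\<^sub>F \<alpha>) K = (\<Sum>I\<in>(\<lambda>i. K - {i}) ` K.
     (- 1) ^ card {(i, j). i \<in> I \<and> j \<in> K - I \<and> j < i} * \<eta> I * \<alpha> (K - I))"
    unfolding wedge_def
  proof (rule sum.mono_neutral_right)
    show "\<forall>I\<in>Pow K - (\<lambda>i. K - {i}) ` K.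
      (- 1) ^ card {(i, j). i \<in> I \<and> j \<in> K - I \<and> j < i} * \<eta> I * \<alpha> (K - I) = 0"
    proof
      fix I assume I: "I \<in> Pow K - (\<lambda>i. K - {i}) ` K"
      have "card (K - I) \<noteq> 1"
      proof
        assume "card (K - I) = 1"
        then obtain i where "K - I = {i}" by (auto simp: card_1_singleton_iff)
        then have "I = K - {i}" "i \<in> K" using I by auto
        then show False using I by blast
      qed
      then show "(- 1) ^ card {(i, j). i \<in> I \<and> j \<in> K - I \<and> j < i} * \<eta> I * \<alpha> (K - I) = 0"
        using assms by (simp add: is_one_form_def)
    qed
  qed auto
  also have "\<dots> = (\<Sum>i\<in>K. (-1) ^ (card K - 1) * (wsign K i * \<alpha> {i} * \<eta> (K - {i})))"
  proof (subst sum.reindex)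
    show "inj_on (\<lambda>i. K - {i}) K" by (auto simp: inj_on_def)
  next
    show "sum ((\<lambda>I. (- 1) ^ card {(i, j). i \<in> I \<and> j \<in> K - I \<and> j < i} * \<eta> I * \<alpha> (K - I)) \<circ> (\<lambda>i. K - {i})) K =
       (\<Sum>i\<in>K. (-1) ^ (card K - 1) * (wsign K i * \<alpha> {i} * \<eta> (K - {i})))"
    proof (rule sum.cong[OF refl])
      fix i assume i: "i \<in> K"
      then have rem: "K - (K - {i}) = {i}" by auto
      then show "((\<lambda>I. (- 1) ^ card {(i, j). i \<in> I \<and> j \<in> K - I \<and> j < i} * \<eta> I * \<alpha> (K - I)) \<circ> (\<lambda>i. K - {i})) i =
        (-1) ^ (card K - 1) * (wsign K i * \<alpha> {i} * \<eta> (K - {i}))"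
        unfolding o_def rem sign[OF i] by (simp only: mult_ac)
    qed
  qed
  also have "\<dots> = (-1) ^ (card K - 1) * (\<alpha> \<and>\<^sub>F \<eta>) K"
    by (simp add: wedge_one_form_left[OF assms] sum_distrib_left)
  finally show ?thesis .
qed

text \<open>
  Both sides are sums over ordered pairs \<open>i \<noteq> j\<close> in \<open>K\<close>. Exchanging the roles of \<open>i\<close> and \<open>j\<close>
  changes exactly one of the two signs, because removing \<open>i\<close> affects the sign of \<open>j\<close> only if
  \<open>i < j\<close>.
\<close>

lemma wedge_anticommute:
  fixes \<alpha> \<beta> :: "('n::{finite,linorder}, 'k::comm_ring_1) form"
  assumes \<alpha>: "is_one_form \<alpha>" and \<beta>: "is_one_form \<beta>"
  shows "(\<alpha> \<and>\<^sub>F \<beta> \<and>\<^sub>F \<eta>) K = - (\<beta> \<and>\<^sub>F \<alpha> \<and>\<^sub>F \<eta>) K"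
proof -
  let ?G = "\<lambda>\<alpha> \<beta> i j. wsign K i * \<alpha> {i} * (wsign (K - {i}) j * \<beta> {j} * \<eta> (K - {i} - {j}))"
  have expand: "(\<alpha> \<and>\<^sub>F \<beta> \<and>\<^sub>F \<eta>) K = (\<Sum>i\<in>K. \<Sum>j\<in>K. if i = j then 0 else ?G \<alpha> \<beta> i j)"
    if "is_one_form \<alpha>" "is_one_form \<beta>" for \<alpha> \<beta> :: "('n, 'k) form"
  proof -
    have "(\<Sum>j\<in>K - {i}. ?G \<alpha> \<beta> i j) = (\<Sum>j\<in>K. if i = j then 0 else ?G \<alpha> \<beta> i j)" for i
      by (rule sum.mono_neutral_cong_left) auto
    then show ?thesis
      by (simp add: wedge_one_form_left that sum_distrib_left)
  qed
  have "?G \<alpha> \<beta> i j = - ?G \<beta> \<alpha> j i" if "i \<in> K" "j \<in> K" "i \<noteq> j" for i j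
  proof -
    have "K - {i} - {j} = K - {j} - {i}" by auto
    then show ?thesis using that
      by (cases "i < j") (auto simp: wsign_remove algebra_simps)
  qed
  then have "(\<Sum>i\<in>K. \<Sum>j\<in>K. if i = j then 0 else ?G \<alpha> \<beta> i j) =
      (\<Sum>i\<in>K. \<Sum>j\<in>K. - (if j = i then 0 else ?G \<beta> \<alpha> j i))"
    by (intro sum.cong refl) auto
  also have "\<dots> = - (\<Sum>j\<in>K. \<Sum>i\<in>K. (if j = i then 0 else ?G \<beta> \<alpha> j i))"
    by (subst sum.swap) (simp add: sum_negf)
  finally show ?thesis unfolding expand[OF \<alpha> \<beta>] expand[OF \<beta> \<alpha>] .
qed

lemma wedge_scale_right:
  fixes \<alpha> :: "('n::{finite,linorder}, 'k::comm_ring_1) form"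
  shows "(\<alpha> \<and>\<^sub>F (\<lambda>I. c * \<eta> I)) K = c * (\<alpha> \<and>\<^sub>F \<eta>) K"
  by (simp add: wedge_def sum_distrib_left algebra_simps)

definition wedge_list :: "('n::{finite,linorder}, 'k::comm_ring_1) form list \<Rightarrow> ('n, 'k) form" where
  "wedge_list vs = foldr (\<and>\<^sub>F) vs one_form"

lemma wedge_list_Nil [simp]: "wedge_list [] = one_form"
  and wedge_list_Cons [simp]: "wedge_list (v # vs) = v \<and>\<^sub>F wedge_list vs"
  by (simp_all add: wedge_list_def)

lemma wedge_list_move:
  assumes "\<And>v. v \<in> set xs \<Longrightarrow> is_one_form v" "is_one_form a"
  shows "wedge_list (xs @ a # ys) = (\<lambda>K. (-1) ^ length xs * wedge_list (a # xs @ ys) K)"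
  using assms(1)
proof (induction xs)
  case (Cons b xs)
  show ?case
  proof
    fix K
    have "wedge_list ((b # xs) @ a # ys) K =
        (b \<and>\<^sub>F (\<lambda>K. (-1) ^ length xs * wedge_list (a # xs @ ys) K)) K"
      using Cons by simp
    also have "\<dots> = (-1) ^ length xs * (b \<and>\<^sub>F a \<and>\<^sub>F wedge_list (xs @ ys)) K"
      by (simp only: wedge_scale_right wedge_list_Cons)
    also have "(b \<and>\<^sub>F a \<and>\<^sub>F wedge_list (xs @ ys)) K = - (a \<and>\<^sub>F b \<and>\<^sub>F wedge_list (xs @ ys)) K"
      using Cons assms(2) by (intro wedge_anticommute) auto
    finally show "wedge_list ((b # xs) @ a # ys) K =
        (-1) ^ length (b # xs) * wedge_list (a # (b # xs) @ ys) K" by simp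
  qed
qed simp

text \<open>
  Moving the second copy of \<open>v\<close> next to the first gives a form that equals its own negative,
  hence is zero in characteristic zero.
\<close>

lemma wedge_repeated:
  fixes v :: "('n::{finite,linorder}, 'k::field_char_0) form"
  assumes "\<And>u. u \<in> set vs \<Longrightarrow> is_one_form u" "v \<in> set vs"
  shows "(v \<and>\<^sub>F wedge_list vs) K = 0"
proof -
  obtain xs ys where vs: "vs = xs @ v # ys" using assms(2) by (meson split_list)
  have v: "is_one_form v" using assms by blast
  have "(v \<and>\<^sub>F v \<and>\<^sub>F wedge_list (xs @ ys)) K = 0"
  proof -
    have "2 * (v \<and>\<^sub>F v \<and>\<^sub>F wedge_list (xs @ ys)) K = 0"
      using wedge_anticommute[OF v v, of "wedge_list (xs @ ys)" K] by simp
    then show ?thesis by (metis mult_eq_0_iff zero_neq_numeral)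
  qed
  moreover have "wedge_list vs = (\<lambda>K. (-1) ^ length xs * wedge_list (v # xs @ ys) K)"
    unfolding vs using assms(1) vs v by (intro wedge_list_move) auto
  ultimately show ?thesis by (simp only: wedge_scale_right wedge_list_Cons mult_zero_right)
qed

lemma wedge_sum_left:
  fixes c :: "'a \<Rightarrow> ('n::{finite,linorder}, 'k::comm_ring_1) mpoly"
  shows "((\<lambda>I. \<Sum>a\<in>A. c a * v a I) \<and>\<^sub>F \<eta>) K = (\<Sum>a\<in>A. c a * (v a \<and>\<^sub>F \<eta>) K)"
  unfolding wedge_def sum_distrib_left sum_distrib_right
  by (subst sum.swap) (simp add: algebra_simps)

text \<open>
  Multiplying the linear relation by the product of all \<open>v a\<close> with \<open>a \<noteq> p, q\<close> removes every
  summand except those of \<open>p\<close> and \<open>q\<close>. The one of \<open>q\<close> is nonzero, so the other must cancel it.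
\<close>

lemma wedge_exchange:
  fixes v :: "'a \<Rightarrow> ('n::{finite,linorder}, 'k::field_char_0) form"
  assumes "finite A" "p \<in> A" "q \<in> A" "p \<noteq> q"
    and "set vs = v ` (A - {p, q})" "\<And>a. is_one_form (v a)"
    and rel: "\<And>I. (\<Sum>a\<in>A. c a * v a I) = 0"
    and cq: "c q \<noteq> 0" and nz: "(v q \<and>\<^sub>F wedge_list vs) K \<noteq> 0"
  shows "(v p \<and>\<^sub>F wedge_list vs) K \<noteq> 0"
proof
  assume p: "(v p \<and>\<^sub>F wedge_list vs) K = 0"
  have "0 = ((\<lambda>I. \<Sum>a\<in>A. c a * v a I) \<and>\<^sub>F wedge_list vs) K"
    by (simp add: rel wedge_def)
  also have "\<dots> = (\<Sum>a\<in>A. c a * (v a \<and>\<^sub>F wedge_list vs) K)"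
    by (rule wedge_sum_left)
  also have "\<dots> = (\<Sum>a\<in>{q}. c a * (v a \<and>\<^sub>F wedge_list vs) K)"
  proof (rule sum.mono_neutral_right)
    show "\<forall>a\<in>A - {q}. c a * (v a \<and>\<^sub>F wedge_list vs) K = 0"
    proof
      fix a assume a: "a \<in> A - {q}"
      show "c a * (v a \<and>\<^sub>F wedge_list vs) K = 0"
      proof (cases "a = p")
        case False
        then have "v a \<in> set vs" using a assms by auto
        then show ?thesis using assms(5,6) by (subst wedge_repeated) auto
      qed (simp add: p)
    qed
  qed (use assms in auto)
  finally have "c q * (v q \<and>\<^sub>F wedge_list vs) K = 0" by simp
  with cq nz show False by (metis mult_eq_0_iff)
qed

section \<open>Too many polynomials are algebraically dependent\<close>

text \<open>
  Gaussian elimination: an equation with a nonzero coefficient at \<open>p\<close> is used to eliminate the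
  unknown \<open>p\<close> from the other equations.
\<close>

lemma underdetermined_system:
  fixes a :: "'s \<Rightarrow> 't \<Rightarrow> 'k::field"
  assumes "finite T" "finite S" "card T < card S"
  shows "\<exists>c. (\<exists>s\<in>S. c s \<noteq> 0) \<and> (\<forall>t\<in>T. (\<Sum>s\<in>S. c s * a s t) = 0)"
  using assms
proof (induction T arbitrary: S a)
  case empty
  then obtain s where "s \<in> S" by fastforce
  then show ?case by (intro exI[of _ "\<lambda>_. 1"]) auto
next
  case (insert t T)
  show ?case
  proof (cases "\<forall>s\<in>S. a s t = 0")
    case True
    obtain c where "\<exists>s\<in>S. c s \<noteq> 0" "\<forall>t\<in>T. (\<Sum>s\<in>S. c s * a s t) = 0"
      using insert.IH[of S a] insert.prems insert.hyps by auto
    then show ?thesis using True by (intro exI[of _ c]) auto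
  next
    case False
    then obtain p where p: "p \<in> S" "a p t \<noteq> 0" by blast
    have "card T < card (S - {p})" "finite (S - {p})" using insert p by auto
    from insert.IH[OF this(2,1), of "\<lambda>s t'. a s t' - a s t / a p t * a p t'"]
    obtain c where c: "\<exists>s\<in>S - {p}. c s \<noteq> 0"
      "\<forall>t'\<in>T. (\<Sum>s\<in>S - {p}. c s * (a s t' - a s t / a p t * a p t')) = 0" by auto
    define c' where "c' = c(p := - (\<Sum>s\<in>S - {p}. c s * a s t) / a p t)"
    have sum: "(\<Sum>s\<in>S. c' s * a s t') =
        (\<Sum>s\<in>S - {p}. c s * a s t') - (\<Sum>s\<in>S - {p}. c s * a s t) / a p t * a p t'" for t'
      using p insert.prems by (simp add: sum.remove[of S p] c'_def)
    show ?thesis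
    proof (intro exI conjI ballI)
      show "\<exists>s\<in>S. c' s \<noteq> 0" using c(1) by (auto simp: c'_def)
    next
      fix t' assume "t' \<in> insert t T"
      then consider "t' = t" | "t' \<in> T" by blast
      then show "(\<Sum>s\<in>S. c' s * a s t') = 0"
      proof cases
        case 2
        then show ?thesis using c(2) unfolding sum
          by (simp add: algebra_simps sum_subtractf sum_distrib_left sum_distrib_right sum_divide_distrib)
      qed (use p in \<open>simp add: sum\<close>)
    qed
  qed
qed

definition exponent_box :: "'i set \<Rightarrow> nat \<Rightarrow> ('i \<Rightarrow>\<^sub>0 nat) set" where
  "exponent_box A N = {m. Poly_Mapping.keys m \<subseteq> A \<and> (\<forall>i. Poly_Mapping.lookup m i \<le> N)}"

lemma exponent_box:
  assumes "finite A"
  shows "finite (exponent_box A N)" "card (exponent_box A N) = (N + 1) ^ card A"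
proof -
  have "bij_betw (\<lambda>m. restrict (Poly_Mapping.lookup m) A) (exponent_box A N) (A \<rightarrow>\<^sub>E {..N})"
  proof (rule bij_betwI[where g = "\<lambda>e. Abs_poly_mapping (\<lambda>i. if i \<in> A then e i else 0)"])
    have fin: "finite {i. (if i \<in> A then e i else 0) \<noteq> (0::nat)}" for e
      using assms by (rule finite_subset[rotated]) auto
    show "(\<lambda>e. Abs_poly_mapping (\<lambda>i. if i \<in> A then e i else 0)) \<in> (A \<rightarrow>\<^sub>E {..N}) \<rightarrow> exponent_box A N"
      using fin by (auto simp: exponent_box_def in_keys_iff PiE_iff split: if_splits)
    show "restrict (Poly_Mapping.lookup (Abs_poly_mapping (\<lambda>i. if i \<in> A then e i else 0))) A = e"
      if "e \<in> A \<rightarrow>\<^sub>E {..N}" for e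
      using that fin by (auto simp: fun_eq_iff PiE_iff extensional_def)
    show "Abs_poly_mapping (\<lambda>i. if i \<in> A then restrict (Poly_Mapping.lookup m) A i else 0) = m"
      if "m \<in> exponent_box A N" for m
    proof (rule poly_mapping_eqI)
      fix i
      have "i \<notin> A \<Longrightarrow> Poly_Mapping.lookup m i = 0"
        using that by (auto simp: exponent_box_def in_keys_iff)
      then show "Poly_Mapping.lookup
          (Abs_poly_mapping (\<lambda>i. if i \<in> A then restrict (Poly_Mapping.lookup m) A i else 0)) i =
          Poly_Mapping.lookup m i"
        using fin[of "restrict (Poly_Mapping.lookup m) A"] by simp
    qed
  qed (auto simp: exponent_box_def)
  from bij_betw_same_card[OF this] bij_betw_finite[OF this] assms
  show "finite (exponent_box A N)" "card (exponent_box A N) = (N + 1) ^ card A"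
    by (simp_all add: finite_PiE card_PiE)
qed

definition exponents_le :: "nat \<Rightarrow> ('n, 'k::zero) mpoly \<Rightarrow> bool" where
  "exponents_le d p \<longleftrightarrow> (\<forall>m\<in>Poly_Mapping.keys p. \<forall>i. Poly_Mapping.lookup m i \<le> d)"

lemma exponents_le_mult:
  assumes "exponents_le d p" "exponents_le e q"
  shows "exponents_le (d + e) (p * q)"
  unfolding exponents_le_def
proof (intro ballI allI)
  fix m i assume "m \<in> Poly_Mapping.keys (p * q)"
  then obtain a b where "m = a + b" "a \<in> Poly_Mapping.keys p" "b \<in> Poly_Mapping.keys q"
    using keys_mult[of p q] by blast
  then show "Poly_Mapping.lookup m i \<le> d + e"
    using assms by (auto simp: exponents_le_def lookup_add add_mono)
qed

lemma exponents_le_one: "exponents_le d 1"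
  by (simp add: exponents_le_def)

lemma exponents_le_power:
  assumes "exponents_le d p"
  shows "exponents_le (a * d) (p ^ a)"
  using assms by (induction a) (auto simp: exponents_le_one intro: exponents_le_mult)

lemma exponents_le_prod:
  assumes "\<And>a. a \<in> A \<Longrightarrow> exponents_le (d a) (p a)"
  shows "exponents_le (sum d A) (prod p A)"
  using assms by (induction A rule: infinite_finite_induct) (auto simp: exponents_le_one intro: exponents_le_mult)

lemma exponents_le_mono: "exponents_le d p \<Longrightarrow> d \<le> e \<Longrightarrow> exponents_le e p"
  unfolding exponents_le_def by (meson le_trans)

lemma exponents_le_exists:
  fixes p :: "('n::finite, 'k::zero) mpoly"
  shows "\<exists>d. exponents_le d p"
proof
  have "Poly_Mapping.lookup m i \<le> (\<Sum>m\<in>Poly_Mapping.keys p. \<Sum>i\<in>UNIV. Poly_Mapping.lookup m i)"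
    if "m \<in> Poly_Mapping.keys p" for m i
  proof -
    have "Poly_Mapping.lookup m i \<le> (\<Sum>i\<in>UNIV. Poly_Mapping.lookup m i)"
      by (rule member_le_sum) auto
    also have "\<dots> \<le> (\<Sum>m\<in>Poly_Mapping.keys p. \<Sum>i\<in>UNIV. Poly_Mapping.lookup m i)"
      using that by (rule member_le_sum) auto
    finally show ?thesis .
  qed
  then show "exponents_le (\<Sum>m\<in>Poly_Mapping.keys p. \<Sum>i\<in>UNIV. Poly_Mapping.lookup m i) p"
    by (simp add: exponents_le_def)
qed

lemma lookup_const_mult: "Poly_Mapping.lookup (const c * p) m = c * Poly_Mapping.lookup p m"
  by (induction p rule: mpoly_induct)
     (simp_all add: const_def mult_single lookup_single when_def distrib_left lookup_add)

text \<open>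
  With all exponents at most \<open>N\<close> there are \<open>(N + 1) ^ card A\<close> monomials in the variables \<open>A\<close>.
  Substituting \<open>h\<close> gives polynomials whose exponents are at most \<open>N * D\<close> for a constant \<open>D\<close>, and
  these live in a space of dimension only \<open>(N * D + 1) ^ n\<close>. As \<open>card A > n\<close>, the first number
  wins for large \<open>N\<close>, so some nontrivial combination of the monomials is mapped to zero.
\<close>

lemma dependent_if_more_than_variables:
  fixes h :: "'i \<Rightarrow> ('n::finite, 'k::field) mpoly"
  assumes A: "finite A" and card: "card A > card (UNIV :: 'n set)"
  shows "\<exists>P. P \<noteq> 0 \<and> vars P \<subseteq> A \<and> subst h P = 0"
proof -
  define n where "n = card (UNIV :: 'n set)"
  define d where "d a = (SOME d. exponents_le d (h a))" for a
  have d: "exponents_le (d a) (h a)" for a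
    unfolding d_def by (rule someI_ex[OF exponents_le_exists])
  define D where "D = sum d A"
  \<comment> \<open>This \<open>N\<close> suffices: \<open>(N * D + 1) ^ n \<le> (N + 1) ^ n * (D + 1) ^ n < (N + 1) ^ (n + 1)\<close>.\<close>
  define N where "N = (D + 1) ^ n"
  define S where "S = exponent_box A N"
  define T where "T = exponent_box (UNIV :: 'n set) (N * D)"
  let ?M = "\<lambda>s. \<Prod>i\<in>A. h i ^ Poly_Mapping.lookup s i"
  have S: "finite S" "card S = (N + 1) ^ card A" using exponent_box[OF A] by (simp_all add: S_def)
  have T: "finite T" "card T = (N * D + 1) ^ n" using exponent_box[of "UNIV :: 'n set"] by (simp_all add: T_def n_def)
  have "card T \<le> ((N + 1) * (D + 1)) ^ n"
    unfolding T by (rule power_mono) auto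
  also have "\<dots> = (N + 1) ^ n * N" by (simp only: power_mult_distrib N_def)
  also have "\<dots> < (N + 1) ^ Suc n" by simp
  also have "\<dots> \<le> card S" unfolding S using card by (intro power_increasing) (auto simp: n_def)
  finally obtain c where c: "\<exists>s\<in>S. c s \<noteq> 0" "\<forall>t\<in>T. (\<Sum>s\<in>S. c s * Poly_Mapping.lookup (?M s) t) = 0"
    using underdetermined_system[OF T(1) S(1), of "\<lambda>s. Poly_Mapping.lookup (?M s)"] by blast
  have small: "Poly_Mapping.lookup (?M s) t = 0" if s: "s \<in> S" and t: "t \<notin> T" for s t
  proof (rule ccontr)
    assume nz: "Poly_Mapping.lookup (?M s) t \<noteq> 0"
    have "exponents_le (\<Sum>i\<in>A. Poly_Mapping.lookup s i * d i) (?M s)"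
      using d by (intro exponents_le_prod exponents_le_power)
    moreover have "(\<Sum>i\<in>A. Poly_Mapping.lookup s i * d i) \<le> N * D"
      unfolding D_def sum_distrib_left using s
      by (intro sum_mono mult_right_mono) (auto simp: S_def exponent_box_def)
    ultimately have "exponents_le (N * D) (?M s)" by (rule exponents_le_mono)
    then have "t \<in> T" using nz by (auto simp: exponents_le_def T_def exponent_box_def in_keys_iff)
    with t show False by simp
  qed
  define P where "P = (\<Sum>s\<in>S. Poly_Mapping.single s (c s))"
  have "Poly_Mapping.lookup P s = c s" if "s \<in> S" for s
    using that S(1) by (simp add: P_def lookup_sum lookup_single when_def sum.delta)
  then have "P \<noteq> 0" using c(1) by force
  moreover have "vars P \<subseteq> A"
  proof
    fix i assume "i \<in> vars P"
    then obtain m where m: "Poly_Mapping.lookup P m \<noteq> 0" "i \<in> Poly_Mapping.keys m"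
      by (auto simp: vars_def in_keys_iff)
    have "m \<in> S"
    proof (rule ccontr)
      assume "m \<notin> S"
      then have "Poly_Mapping.lookup P m = 0"
        unfolding P_def lookup_sum lookup_single by (intro sum.neutral) (auto simp: when_def)
      with m show False by simp
    qed
    then show "i \<in> A" using m(2) by (auto simp: S_def exponent_box_def)
  qed
  moreover have "subst h P = 0"
  proof (rule poly_mapping_eqI)
    fix t
    have "subst h P = (\<Sum>s\<in>S. const (c s) * ?M s)"
      unfolding P_def subst_sum
      by (intro sum.cong refl subst_single A) (auto simp: S_def exponent_box_def)
    then have "Poly_Mapping.lookup (subst h P) t = (\<Sum>s\<in>S. c s * Poly_Mapping.lookup (?M s) t)"
      by (simp add: lookup_sum lookup_const_mult)
    also have "\<dots> = 0" using c(2) small by (cases "t \<in> T") auto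
    finally show "Poly_Mapping.lookup (subst h P) t = Poly_Mapping.lookup 0 t" by simp
  qed
  ultimately show ?thesis by blast
qed

section \<open>The Jacobian criterion\<close>

text \<open>
  A partial derivative has smaller degree in the variables \<open>A\<close>. If it is nonzero, it therefore
  cannot be a relation again once the degree of the relation is least possible.
\<close>

lemma minimal_relation:
  fixes h :: "'i \<Rightarrow> ('n, 'k::comm_ring_1) mpoly"
  assumes "finite A" and ex: "P\<^sub>0 \<noteq> 0" "vars P\<^sub>0 \<subseteq> A" "subst h P\<^sub>0 = 0"
  obtains P where "P \<noteq> 0" "vars P \<subseteq> A" "subst h P = 0"
    "\<And>i. partial i P \<noteq> 0 \<Longrightarrow> subst h (partial i P) \<noteq> 0"
proof -
  define tdeg where "tdeg m = (\<Sum>i\<in>A. Poly_Mapping.lookup m i)" for m :: "'i \<Rightarrow>\<^sub>0 nat"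
  define R where "R d \<longleftrightarrow> (\<exists>P. P \<noteq> 0 \<and> vars P \<subseteq> A \<and> subst h P = 0 \<and>
      (\<forall>m\<in>Poly_Mapping.keys P. tdeg m \<le> d))" for d
  have "R (\<Sum>m\<in>Poly_Mapping.keys P\<^sub>0. tdeg m)"
    unfolding R_def using ex by (intro exI[of _ P\<^sub>0]) (auto intro: member_le_sum)
  then have least: "R (LEAST d. R d)" "\<And>d. d < (LEAST d. R d) \<Longrightarrow> \<not> R d"
    by (auto intro: LeastI dest: not_less_Least)
  define d where "d = (LEAST d. R d)"
  obtain P where P: "P \<noteq> 0" "vars P \<subseteq> A" "subst h P = 0" "\<forall>m\<in>Poly_Mapping.keys P. tdeg m \<le> d"
    using least(1) unfolding R_def d_def by blast
  show thesis
  proof (rule that[OF P(1-3)])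
    fix i assume nz: "partial i P \<noteq> 0"
    have keys: "tdeg m < d" if "m \<in> Poly_Mapping.keys (partial i P)" for m
    proof -
      have m: "m + Poly_Mapping.single i 1 \<in> Poly_Mapping.keys P"
        using that by (auto simp: in_keys_iff lookup_partial)
      then have "i \<in> vars P" unfolding vars_def by (auto simp: in_keys_iff lookup_add intro!: bexI[OF _ m])
      then have "i \<in> A" using P(2) by blast
      then have "tdeg (m + Poly_Mapping.single i 1) = tdeg m + 1"
        using assms(1) by (simp add: tdeg_def lookup_add sum.distrib lookup_single when_def sum.delta)
      then show ?thesis using P(4) m by fastforce
    qed
    show "subst h (partial i P) \<noteq> 0"
    proof
      assume z: "subst h (partial i P) = 0"
      obtain m where "m \<in> Poly_Mapping.keys (partial i P)" using keys_nonempty[OF nz] by blast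
      then have "d > 0" using keys by fastforce
      moreover have "R (d - 1)"
        unfolding R_def using nz z P(2) vars_partial[of i P] keys \<open>d > 0\<close>
        by (intro exI[of _ "partial i P"]) fastforce
      ultimately show False using least(2)[of "d - 1"] by (simp add: d_def)
    qed
  qed
qed

definition variable :: "'n \<Rightarrow> ('n, 'k::comm_ring_1) mpoly" where
  "variable i = Poly_Mapping.single (Poly_Mapping.single i 1) 1"

lemma partial_variable: "partial j (variable i) = (if i = j then 1 else 0)"
  by (auto simp: variable_def partial_single lookup_single when_def)

text \<open>
  Multiplying by the smallest variable from the left involves no sign, so the product in
  increasing order has coefficient \<open>1\<close>.
\<close>

lemma wedge_variables:
  fixes xs :: "'n::{finite,linorder} list"
  assumes "sorted_wrt (<) xs"
  shows "wedge_list (map (\<lambda>i. differential (variable i :: ('n, 'k::comm_ring_1) mpoly)) xs) (set xs) = 1"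
  using assms
proof (induction xs)
  case (Cons a xs)
  let ?v = "\<lambda>i. differential (variable i :: ('n, 'k) mpoly)"
  have a: "a \<notin> set xs" "{j \<in> set (a # xs). j < a} = {}" using Cons by auto
  have "wsign (set (a # xs)) i * ?v a {i} * wedge_list (map ?v xs) (set (a # xs) - {i}) =
      (if i = a then wedge_list (map ?v xs) (set xs) else 0)" for i
  proof (cases "i = a")
    case True
    have "set (a # xs) - {a} = set xs" using a(1) by auto
    then show ?thesis unfolding True wsign_def a(2) by (simp add: partial_variable)
  qed (simp add: partial_variable)
  then have "wedge_list (map ?v (a # xs)) (set (a # xs)) =
      (\<Sum>i\<in>set (a # xs). if i = a then wedge_list (map ?v xs) (set xs) else 0)"
    by (simp only: list.map wedge_list_Cons wedge_one_form_left is_one_form_differential)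
  also have "\<dots> = 1" using Cons by (simp add: sum.delta)
  finally show ?case .
qed (simp add: one_form_def)

lemma wedge_list_append_zero:
  assumes "wedge_list ys = (\<lambda>_. 0)"
  shows "wedge_list (xs @ ys) = (\<lambda>_. 0)"
  using assms by (induction xs) (auto simp: wedge_def fun_eq_iff)

lemma subst_cong:
  assumes "\<And>i. i \<in> vars P \<Longrightarrow> f i = g i"
  shows "subst f P = subst g P"
proof -
  have "f i = g i" if "m \<in> Poly_Mapping.keys P" "i \<in> Poly_Mapping.keys m" for m i
    using assms[of i] that by (auto simp: vars_def)
  then show ?thesis
    unfolding subst_def by (intro sum.cong arg_cong2[where f="(*)"] prod.cong) auto
qed

lemma wedge_list_differentials:
  "wedge_differentials f r = wedge_list (map (\<lambda>i. differential (f i)) [1..<Suc r])"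
  by (simp add: wedge_differentials_def wedge_list_def)

text \<open>
  The polynomials \<open>h 1, \<dots>, h r\<close> are independent, and the variables \<open>x\<^sub>1, \<dots>, x\<^sub>n\<close> are numbered
  from \<open>r + 1\<close> on, so that a relation among both kinds is a polynomial in a single family of
  unknowns. The list \<open>js\<close> holds the numbers of the variables that have not been exchanged yet.
\<close>

lemma wedge_complete:
  fixes h :: "nat \<Rightarrow> ('n::{finite,linorder}, 'k::field_char_0) mpoly"
  assumes ind: "alg_independent h r"
    and vars: "\<And>i. i < card (UNIV :: 'n set) \<Longrightarrow>
       h (Suc r + i) = variable (sorted_list_of_set UNIV ! i)"
    and "k \<le> r"
  shows "\<exists>js K. distinct js \<and> set js \<subseteq> {r<..} \<and> length js + k = card (UNIV :: 'n set) \<and>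
     wedge_list (map (\<lambda>i. differential (h i)) (js @ [1..<Suc k])) K \<noteq> 0"
  using \<open>k \<le> r\<close>
proof (induction k)
  case 0
  define xs :: "'n list" where "xs = sorted_list_of_set UNIV"
  have xs: "length xs = card (UNIV :: 'n set)" "sorted_wrt (<) xs" by (simp_all add: xs_def)
  define js where "js = [Suc r..<Suc r + card (UNIV :: 'n set)]"
  have "map h js = map variable xs"
    using vars xs(1) by (intro nth_equalityI) (simp_all add: xs_def js_def del: upt_Suc)
  then have "map differential (map h js) = map differential (map variable xs)" by simp
  then have "map (\<lambda>i. differential (h i)) js = map (\<lambda>i. differential (variable i)) xs"
    by (simp add: o_def)
  then have "wedge_list (map (\<lambda>i. differential (h i)) (js @ [1..<Suc 0])) (set xs) = 1"
    using wedge_variables[OF xs(2)] by simp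
  moreover have "distinct js" "set js \<subseteq> {r<..}" "length js = card (UNIV :: 'n set)"
    by (auto simp: js_def simp del: upt_Suc)
  ultimately show ?case by (intro exI[of _ js] exI[of _ "set xs"]) auto
next
  case (Suc k)
  let ?v = "\<lambda>i. differential (h i)"
  obtain js K where js: "distinct js" "set js \<subseteq> {r<..}" "length js + k = card (UNIV :: 'n set)"
    and nz: "wedge_list (map ?v (js @ [1..<Suc k])) K \<noteq> 0"
    using Suc by auto
  define A where "A = {1..Suc k} \<union> set js"
  have "card A = Suc k + length js"
    unfolding A_def using js Suc.prems by (subst card_Un_disjoint) (auto simp: distinct_card)
  then have cA: "card A > card (UNIV :: 'n set)" and fA: "finite A" using js(3) by (auto simp: A_def)
  obtain P\<^sub>0 where P0: "P\<^sub>0 \<noteq> 0" "vars P\<^sub>0 \<subseteq> A" "subst h P\<^sub>0 = 0"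
    using dependent_if_more_than_variables[OF fA cA, of h] by blast
  obtain P where P: "P \<noteq> 0" "vars P \<subseteq> A" "subst h P = 0"
    "\<And>i. partial i P \<noteq> 0 \<Longrightarrow> subst h (partial i P) \<noteq> 0"
    using minimal_relation[OF fA P0] by metis
  have "\<not> vars P \<subseteq> {1..r}" using ind P by (auto simp: alg_independent_def)
  then obtain q where "q \<in> vars P" "q \<notin> {1..r}" by blast
  moreover from this have "q \<in> set js" using P(2) Suc.prems by (auto simp: A_def)
  ultimately have q: "q \<in> vars P" "q \<in> set js" by simp_all
  \<comment> \<open>Here characteristic zero enters: differentiation multiplies by the exponent of \<open>q\<close>.\<close>
  have "partial q P \<noteq> 0"
  proof -
    obtain m where m: "m \<in> Poly_Mapping.keys P" "q \<in> Poly_Mapping.keys m"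
      using q(1) by (auto simp: vars_def)
    then have "m - Poly_Mapping.single q 1 + Poly_Mapping.single q 1 = m"
      by (intro poly_mapping_eqI) (auto simp: lookup_add lookup_minus lookup_single when_def in_keys_iff)
    then have "Poly_Mapping.lookup (partial q P) (m - Poly_Mapping.single q 1) =
        of_nat (Poly_Mapping.lookup (m - Poly_Mapping.single q 1) q + 1) * Poly_Mapping.lookup P m"
      by (simp add: lookup_partial)
    also have "\<dots> \<noteq> 0" using m(1) by (simp only: mult_eq_0_iff of_nat_eq_0_iff) (simp add: in_keys_iff)
    finally show ?thesis by auto
  qed
  then have cq: "subst h (partial q P) \<noteq> 0" by (rule P(4))
  have rel: "(\<Sum>a\<in>A. subst h (partial a P) * ?v a I) = 0" for I
  proof (cases "card I = 1")
    case True
    then have "(\<Sum>a\<in>A. subst h (partial a P) * ?v a I) = partial (the_elem I) (subst h P)"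
      by (simp add: differential_def partial_subst[OF fA P(2)])
    then show ?thesis by (simp add: P(3))
  qed (simp add: differential_def)
  obtain js1 js2 where split: "js = js1 @ q # js2" using q(2) by (meson split_list)
  define rs where "rs = js1 @ js2 @ [1..<Suc k]"
  have one: "is_one_form (?v a)" for a by (rule is_one_form_differential)
  have "wedge_list (map ?v js1 @ ?v q # map ?v (js2 @ [1..<Suc k])) K \<noteq> 0"
    using nz by (simp add: split)
  then have nzq: "(?v q \<and>\<^sub>F wedge_list (map ?v rs)) K \<noteq> 0"
    by (subst (asm) wedge_list_move) (auto simp: one rs_def)
  have "A - {Suc k, q} = set rs"
    using js split Suc.prems q(2) by (auto simp: A_def rs_def)
  then have set: "set (map ?v rs) = ?v ` (A - {Suc k, q})" by simp
  have "q \<noteq> Suc k" using js(2) q(2) Suc.prems by auto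
  then have "(?v (Suc k) \<and>\<^sub>F wedge_list (map ?v rs)) K \<noteq> 0"
    using q(2)
    by (intro wedge_exchange[OF fA _ _ _ set one rel cq nzq]) (auto simp: A_def)
  moreover have "wedge_list (map ?v rs @ [?v (Suc k)]) =
      (\<lambda>K. (-1) ^ length rs * wedge_list (?v (Suc k) # map ?v rs) K)"
    using wedge_list_move[of "map ?v rs" "?v (Suc k)" "[]"] one by auto
  ultimately have "wedge_list (map ?v rs @ [?v (Suc k)]) K \<noteq> 0"
    by simp
  moreover have "map ?v rs @ [?v (Suc k)] = map ?v ((js1 @ js2) @ [1..<Suc (Suc k)])"
    by (simp add: rs_def)
  ultimately show ?case
    using js split by (intro exI[of _ "js1 @ js2"] exI[of _ K]) auto
qed

text \<open>
  A product that can be completed to a nonzero product by further factors is nonzero itself.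
\<close>

theorem wedge_differentials_nonzero:
  fixes f :: "nat \<Rightarrow> ('n::{finite,linorder}, 'k::field_char_0) mpoly"
  assumes "alg_independent f r"
  shows "\<exists>I. wedge_differentials f r I \<noteq> 0"
proof (rule ccontr)
  assume "\<not> ?thesis"
  then have zero: "wedge_differentials f r = (\<lambda>_. 0)" by auto
  define h where "h i = (if i \<le> r then f i else variable (sorted_list_of_set (UNIV :: 'n set) ! (i - Suc r)))" for i
  have ind: "alg_independent h r"
    unfolding alg_independent_def
  proof (intro allI impI)
    fix P :: "(nat, 'k) mpoly" assume P: "vars P \<subseteq> {1..r}" "subst h P = 0"
    have "subst h P = subst f P" using P(1) by (intro subst_cong) (auto simp: h_def)
    then show "P = 0" using assms P by (auto simp: alg_independent_def)
  qed
  obtain js K where nz: "wedge_list (map (\<lambda>i. differential (h i)) (js @ [1..<Suc r])) K \<noteq> 0"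
    using wedge_complete[OF ind _ order.refl] by (auto simp: h_def)
  have hf: "map (\<lambda>i. differential (h i)) [1..<Suc r] = map (\<lambda>i. differential (f i)) [1..<Suc r]"
    by (intro map_cong) (auto simp: h_def)
  have "wedge_list (map (\<lambda>i. differential (h i)) js @ map (\<lambda>i. differential (f i)) [1..<Suc r]) K \<noteq> 0"
    using nz unfolding map_append hf .
  moreover have "wedge_list (map (\<lambda>i. differential (h i)) js @ map (\<lambda>i. differential (f i)) [1..<Suc r]) = (\<lambda>_. 0)"
    using zero by (intro wedge_list_append_zero) (simp only: wedge_list_differentials)
  ultimately show False by simp
qed

section \<open>Degrees of forms\<close>

lemma form_wdeg_le_iff:
  fixes \<eta> :: "('n::finite, 'k::comm_ring_1) form"
  shows "form_wdeg w \<eta> \<le> x \<longleftrightarrow> (\<forall>I. wdeg w (\<eta> I) + Fin (\<Sum>i\<in>I. w i) \<le> x)"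
  unfolding form_wdeg_def by (subst Max_le_iff) auto

lemma form_wdeg_ge:
  fixes \<eta> :: "('n::finite, 'k::comm_ring_1) form"
  shows "wdeg w (\<eta> I) + Fin (\<Sum>i\<in>I. w i) \<le> form_wdeg w \<eta>"
  using form_wdeg_le_iff[of w \<eta> "form_wdeg w \<eta>"] by simp

lemma form_wdeg_attained:
  fixes \<eta> :: "('n::finite, 'k::comm_ring_1) form"
  obtains I where "form_wdeg w \<eta> = wdeg w (\<eta> I) + Fin (\<Sum>i\<in>I. w i)"
proof -
  have "form_wdeg w \<eta> \<in> range (\<lambda>I. wdeg w (\<eta> I) + Fin (\<Sum>i\<in>I. w i))"
    unfolding form_wdeg_def by (rule Max_in) auto
  then show thesis using that by blast
qed

lemma form_wdeg_neq_Pinf [simp]: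
  fixes \<eta> :: "('n::finite, 'k::comm_ring_1) form"
  shows "form_wdeg w \<eta> \<noteq> Pinf"
proof -
  obtain I where "form_wdeg w \<eta> = wdeg w (\<eta> I) + Fin (\<Sum>i\<in>I. w i)" by (rule form_wdeg_attained)
  then show ?thesis by (cases "wdeg w (\<eta> I)") (auto simp: wdeg_neq_Pinf)
qed

lemma form_wdeg_scale_ge:
  fixes \<eta> :: "('n::{finite,linorder}, 'k::idom) form"
  shows "wdeg w c + form_wdeg w \<eta> \<le> form_wdeg w (\<lambda>I. c * \<eta> I)"
proof -
  obtain I where "form_wdeg w \<eta> = wdeg w (\<eta> I) + Fin (\<Sum>i\<in>I. w i)" by (rule form_wdeg_attained)
  then have "wdeg w c + form_wdeg w \<eta> = wdeg w (c * \<eta> I) + Fin (\<Sum>i\<in>I. w i)"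
    by (simp add: wdeg_mult add.assoc)
  then show ?thesis using form_wdeg_ge[of w "\<lambda>I. c * \<eta> I" I] by simp
qed

lemma wdeg_sign_mult:
  fixes p :: "('n::finite, 'k::comm_ring_1) mpoly"
  shows "wdeg w ((-1) ^ a * p) = wdeg w p"
proof -
  have "Poly_Mapping.keys (- p) = Poly_Mapping.keys p" by (auto simp: in_keys_iff)
  then have "wdeg w (- p) = wdeg w p" by (simp add: wdeg_def homog_component_nonzero_iff)
  then show ?thesis by (cases "even a") simp_all
qed

text \<open>
  The coefficient at \<open>K\<close> is a signed sum of products of \<open>\<eta> (K - {i})\<close> and \<open>partial i p\<close>. The
  weight \<open>w i\<close> that the derivative loses is what \<open>K\<close> has in excess of \<open>K - {i}\<close>.
\<close>

lemma form_wdeg_wedge_differential_le: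
  fixes \<eta> :: "('n::{finite,linorder}, 'k::idom) form"
  shows "form_wdeg w (\<eta> \<and>\<^sub>F differential p) \<le> form_wdeg w \<eta> + wdeg w p"
  unfolding form_wdeg_le_iff
proof
  fix K :: "'n set"
  let ?s = "\<Sum>i\<in>K. w i"
  have cancel: "x + Fin a \<le> y \<longleftrightarrow> x \<le> y + Fin (- a)" for x y :: "'b::linordered_ab_group_add extended" and a
    by (cases x; cases y) (auto simp: algebra_simps)
  have "wdeg w ((-1) ^ (card K - 1) * (wsign K i * differential p {i} * \<eta> (K - {i})))
      \<le> form_wdeg w \<eta> + wdeg w p + Fin (- ?s)" if "i \<in> K" for i
  proof -
    have s: "?s = w i + (\<Sum>i\<in>K - {i}. w i)" using that by (simp add: sum.remove)
    have "wdeg w ((-1) ^ (card K - 1) * (wsign K i * differential p {i} * \<eta> (K - {i}))) + Fin ?s =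
        (wdeg w (\<eta> (K - {i})) + Fin (\<Sum>i\<in>K - {i}. w i)) + (wdeg w (partial i p) + Fin (w i))"
      unfolding wsign_def mult.assoc wdeg_sign_mult
      by (simp add: wdeg_mult s ac_simps flip: plus_extended.simps(1))
    also have "\<dots> \<le> form_wdeg w \<eta> + wdeg w p"
      by (intro add_mono form_wdeg_ge wdeg_partial_le)
    finally show ?thesis by (simp add: cancel)
  qed
  then have "wdeg w ((\<eta> \<and>\<^sub>F differential p) K) \<le> form_wdeg w \<eta> + wdeg w p + Fin (- ?s)"
    by (simp only: wedge_one_form_right is_one_form_differential wedge_one_form_left sum_distrib_left)
       (rule wdeg_sum_le)
  then show "wdeg w ((\<eta> \<and>\<^sub>F differential p) K) + Fin ?s \<le> form_wdeg w \<eta> + wdeg w p"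
    by (simp add: cancel)
qed

section \<open>Multiplying differentials by \<omega>\<close>

lemma wedge_differential_mult:
  "(\<omega> \<and>\<^sub>F differential (p * q)) K = q * (\<omega> \<and>\<^sub>F differential p) K + p * (\<omega> \<and>\<^sub>F differential q) K"
  by (simp add: wedge_def differential_def partial_mult if_distrib sum_distrib_left algebra_simps
      flip: sum.distrib cong: if_cong)

lemma wedge_differential_add:
  "(\<omega> \<and>\<^sub>F differential (p + q)) K = (\<omega> \<and>\<^sub>F differential p) K + (\<omega> \<and>\<^sub>F differential q) K"
  unfolding wedge_def sum.distrib[symmetric]
  by (intro sum.cong refl) (simp add: differential_def partial_add algebra_simps)

text \<open>
  By the Leibniz rule \<open>d(\<Phi>(g))\<close> is \<open>\<Phi>'(g) dg\<close> plus multiples of the differentials of the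
  coefficients, which \<open>\<omega>\<close> annihilates.
\<close>

lemma wedge_differential_poly:
  fixes \<Phi> :: "('n::{finite,linorder}, 'k::idom) mpoly poly"
  assumes "\<And>i. \<omega> \<and>\<^sub>F differential (coeff \<Phi> i) = (\<lambda>_. 0)"
  shows "\<omega> \<and>\<^sub>F differential (poly \<Phi> g) = (\<lambda>K. poly (pderiv \<Phi>) g * (\<omega> \<and>\<^sub>F differential g) K)"
  using assms
proof (induction \<Phi>)
  case 0
  from this[of 0] show ?case by simp
next
  case (pCons a \<Phi>)
  have "\<omega> \<and>\<^sub>F differential a = (\<lambda>_. 0)" using pCons.prems[of 0] by simp
  moreover have "\<omega> \<and>\<^sub>F differential (coeff \<Phi> i) = (\<lambda>_. 0)" for i using pCons.prems[of "Suc i"] by simp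
  note pCons.IH[OF this]
  ultimately show ?case
    by (simp add: fun_eq_iff wedge_differential_add wedge_differential_mult pderiv_pCons algebra_simps)
qed

text \<open>
  By the chain rule \<open>dp\<close> is a linear combination of \<open>df\<^sub>1, \<dots>, df\<^sub>r\<close>, all of which are factors of
  \<open>\<omega>\<close>.
\<close>

lemma wedge_differential_gen_subalgebra:
  fixes f :: "nat \<Rightarrow> ('n::{finite,linorder}, 'k::field_char_0) mpoly"
  assumes "p \<in> gen_subalgebra f r"
  shows "wedge_differentials f r \<and>\<^sub>F differential p = (\<lambda>_. 0)"
proof
  fix K
  let ?vs = "map (\<lambda>i. differential (f i)) [1..<Suc r]"
  obtain P where P: "p = subst f P" "vars P \<subseteq> {1..r}"
    using assms by (auto simp: gen_subalgebra_def)
  have d: "differential p = (\<lambda>I. \<Sum>a\<in>{1..r}. subst f (partial a P) * differential (f a) I)"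
    by (rule ext) (simp add: P(1) differential_def partial_subst[OF _ P(2)])
  have "(differential p \<and>\<^sub>F wedge_list ?vs) K =
      (\<Sum>a\<in>{1..r}. subst f (partial a P) * (differential (f a) \<and>\<^sub>F wedge_list ?vs) K)"
    unfolding d by (rule wedge_sum_left)
  also have "\<dots> = 0"
  proof (intro sum.neutral ballI)
    fix a assume "a \<in> {1..r}"
    then have "(differential (f a) \<and>\<^sub>F wedge_list ?vs) K = 0"
      by (intro wedge_repeated) (auto simp: is_one_form_differential simp del: upt_Suc)
    then show "subst f (partial a P) * (differential (f a) \<and>\<^sub>F wedge_list ?vs) K = 0" by simp
  qed
  finally show "(wedge_differentials f r \<and>\<^sub>F differential p) K = 0"
    by (simp only: wedge_one_form_right is_one_form_differential wedge_list_differentials mult_zero_right)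
qed

text \<open>
  Coefficients annihilated by \<open>\<omega> \<and> d\<close> remain so under \<open>\<partial>/\<partial>y\<close>, which only rescales them by
  integers; this allows \<open>wedge_differential_poly\<close> to be iterated.
\<close>

lemma wedge_differential_coeff_pderiv:
  fixes \<Phi> :: "('n::{finite,linorder}, 'k::{idom, ring_char_0}) mpoly poly"
  assumes "\<And>i. \<omega> \<and>\<^sub>F differential (coeff \<Phi> i) = (\<lambda>_. 0)"
  shows "\<omega> \<and>\<^sub>F differential (coeff ((pderiv ^^ m) \<Phi>) i) = (\<lambda>_. 0)"
proof (induction m arbitrary: i)
  case (Suc m)
  have "partial j (of_nat a :: ('n, 'k) mpoly) = 0" for j and a
    by (simp flip: const_of_nat)
  then have "differential (of_nat a :: ('n, 'k) mpoly) = (\<lambda>_. 0)" for a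
    by (auto simp: fun_eq_iff differential_def)
  then have "\<omega> \<and>\<^sub>F differential (of_nat a :: ('n, 'k) mpoly) = (\<lambda>_. 0)" for a
    by (simp add: fun_eq_iff wedge_def)
  then show ?case using Suc[of "Suc i"]
    unfolding funpow.simps o_def coeff_pderiv
    by (simp only: fun_eq_iff wedge_differential_mult) simp
qed (use assms in simp)

section \<open>Degrees of polynomials in y relative to g\<close>

lemma finite_range_wdeg_coeff: "finite (range (\<lambda>i. wdeg w (coeff \<Phi> i * g ^ i)))"
proof -
  have "wdeg w (coeff \<Phi> i * g ^ i) = Minf" if "\<not> i \<le> degree \<Phi>" for i
    using that by (simp add: coeff_eq_0)
  then have "range (\<lambda>i. wdeg w (coeff \<Phi> i * g ^ i)) \<subseteq>
      insert Minf ((\<lambda>i. wdeg w (coeff \<Phi> i * g ^ i)) ` {..degree \<Phi>})"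
    by blast
  then show ?thesis by (rule finite_subset) simp
qed

lemma wdeg_at_le_iff: "wdeg_at w g \<Phi> \<le> x \<longleftrightarrow> (\<forall>i. wdeg w (coeff \<Phi> i * g ^ i) \<le> x)"
  unfolding wdeg_at_def by (subst Max_le_iff) (auto simp: finite_range_wdeg_coeff)

lemma wdeg_at_attained:
  obtains i where "wdeg_at w g \<Phi> = wdeg w (coeff \<Phi> i * g ^ i)"
proof -
  have "wdeg_at w g \<Phi> \<in> range (\<lambda>i. wdeg w (coeff \<Phi> i * g ^ i))"
    unfolding wdeg_at_def by (rule Max_in) (auto simp: finite_range_wdeg_coeff)
  then show thesis using that by blast
qed

lemma wdeg_at_finite:
  fixes g :: "('n::{finite,linorder}, 'k::idom) mpoly"
  assumes "\<Phi> \<noteq> 0" "g \<noteq> 0"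
  obtains \<gamma> where "wdeg_at w g \<Phi> = Fin \<gamma>"
proof -
  obtain i where i: "coeff \<Phi> i \<noteq> 0" using assms(1) by (auto simp: poly_eq_iff)
  have "wdeg w (coeff \<Phi> i * g ^ i) \<le> wdeg_at w g \<Phi>" using wdeg_at_le_iff by blast
  moreover have "coeff \<Phi> i * g ^ i \<noteq> 0" using i assms(2) by simp
  moreover obtain j where j: "wdeg_at w g \<Phi> = wdeg w (coeff \<Phi> j * g ^ j)" by (rule wdeg_at_attained)
  ultimately have "coeff \<Phi> j * g ^ j \<noteq> 0"
    by (metis wdeg_eq_Minf_iff le_Minf)
  with j show thesis using that wdeg_eq_Max by metis
qed

text \<open>
  The summand of index \<open>i + 1\<close> of \<open>\<Phi>(g)\<close> is, up to the nonzero integer \<open>i + 1\<close>, the product of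
  \<open>g\<close> and the summand of index \<open>i\<close> of \<open>\<Phi>'(g)\<close>. So the claim holds as soon as the top degree occurs
  at a positive index. If it occurred at index \<open>0\<close> only, nothing could cancel this term and
  \<open>\<Phi>(g)\<close> would have the top degree itself.
\<close>

lemma wdeg_at_pderiv:
  fixes g :: "('n::{finite,linorder}, 'k::{idom,ring_char_0}) mpoly"
  assumes "\<Phi> \<noteq> 0" and g: "wdeg w g = Fin \<delta>" and ne: "wdeg_at w g \<Phi> \<noteq> wdeg w (poly \<Phi> g)"
  shows "wdeg_at w g (pderiv \<Phi>) + Fin \<delta> = wdeg_at w g \<Phi>"
proof -
  let ?t = "\<lambda>i. coeff \<Phi> i * g ^ i"
  have g0: "g \<noteq> 0" using g by auto
  obtain \<gamma> where \<gamma>: "wdeg_at w g \<Phi> = Fin \<gamma>" using wdeg_at_finite[OF assms(1) g0] .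
  have shifted: "wdeg w (coeff (pderiv \<Phi>) i * g ^ i) + Fin \<delta> = wdeg w (?t (Suc i))" for i
  proof -
    have "wdeg w (of_nat (Suc i) * (?t (Suc i))) = wdeg w (?t (Suc i))"
    proof -
      have "weight w 0 = 0" using weight_add[of w 0 0] by simp
      moreover have "(of_nat (Suc i) :: ('n, 'k) mpoly) \<noteq> 0" by (simp only: of_nat_eq_0_iff)
      moreover have "Poly_Mapping.keys (of_nat (Suc i) :: ('n, 'k) mpoly) = {0}"
        unfolding const_of_nat[symmetric] const_def by (simp only: keys_single of_nat_eq_0_iff) simp
      ultimately have "wdeg w (of_nat (Suc i) :: ('n, 'k) mpoly) = 0"
        by (simp add: wdeg_eq_Max zero_extended_def del: of_nat_Suc)
      then show ?thesis by (simp add: wdeg_mult del: of_nat_Suc)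
    qed
    moreover have "of_nat (Suc i) * (?t (Suc i)) = coeff (pderiv \<Phi>) i * g ^ i * g"
      by (simp add: coeff_pderiv algebra_simps)
    ultimately show ?thesis by (metis wdeg_mult g)
  qed
  have "\<exists>i. wdeg w (?t (Suc i)) = Fin \<gamma>"
  proof (rule ccontr)
    assume none: "\<nexists>i. wdeg w (?t (Suc i)) = Fin \<gamma>"
    obtain i where "Fin \<gamma> = wdeg w (?t i)" using wdeg_at_attained[of w g \<Phi>] \<gamma> by metis
    then have t0: "wdeg w (coeff \<Phi> 0) = Fin \<gamma>" using none by (cases i) auto
    have le: "wdeg w (?t i) \<le> Fin \<gamma>" for i using wdeg_at_le_iff[of w g \<Phi> "Fin \<gamma>"] \<gamma> by simp
    have lt: "wdeg w (?t (Suc i)) < Fin \<gamma>" for i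
      using le[of "Suc i"] none by (simp add: order.strict_iff_order)
    define R where "R = (\<Sum>i\<in>{1..degree \<Phi>}. ?t i)"
    have eq: "poly \<Phi> g = coeff \<Phi> 0 + R"
      unfolding poly_altdef R_def by (simp add: sum.atMost_shift lessThan_atLeast0 sum.shift_bounds_Suc_ivl atMost_atLeast0 sum.atLeast_Suc_atMost)
    have "\<exists>x. x < Fin \<gamma> \<and> (\<forall>i\<in>{1..degree \<Phi>}. wdeg w (?t i) \<le> x)"
    proof -
      let ?x = "Max (insert Minf ((\<lambda>i. wdeg w (?t i)) ` {1..degree \<Phi>}))"
      have "wdeg w (?t i) < Fin \<gamma>" if "i \<in> {1..degree \<Phi>}" for i
        using that lt[of "i - 1"] by simp
      then have "?x < Fin \<gamma>" by (subst Max_less_iff) auto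
      then show ?thesis by (intro exI[of _ ?x]) auto
    qed
    then obtain x where x: "x < Fin \<gamma>" "\<forall>i\<in>{1..degree \<Phi>}. wdeg w (?t i) \<le> x" by blast
    then have R: "wdeg w R \<le> x" unfolding R_def by (intro wdeg_sum_le) auto
    have "wdeg w (poly \<Phi> g) \<le> Fin \<gamma>"
      unfolding eq using R x t0 by (intro wdeg_add_le) auto
    moreover have "\<not> wdeg w (poly \<Phi> g) < Fin \<gamma>"
    proof
      assume less: "wdeg w (poly \<Phi> g) < Fin \<gamma>"
      have "wdeg w (- R) = wdeg w R" using wdeg_sign_mult[of w 1 R] by simp
      then have "wdeg w (poly \<Phi> g + - R) \<le> max (wdeg w (poly \<Phi> g)) x"
        using R by (intro wdeg_add_le) (auto simp: le_max_iff_disj)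
      also have "\<dots> < Fin \<gamma>" using less x by simp
      finally show False using t0 eq by simp
    qed
    ultimately have "wdeg w (poly \<Phi> g) = Fin \<gamma>" by simp
    with ne \<gamma> show False by simp
  qed
  then obtain i where i: "wdeg w (?t (Suc i)) = Fin \<gamma>" by blast
  obtain j where j: "wdeg_at w g (pderiv \<Phi>) = wdeg w (coeff (pderiv \<Phi>) j * g ^ j)" by (rule wdeg_at_attained)
  have "wdeg_at w g (pderiv \<Phi>) + Fin \<delta> \<le> Fin \<gamma>"
    unfolding j shifted using wdeg_at_le_iff[of w g \<Phi> "Fin \<gamma>"] \<gamma> by (simp del: power_Suc)
  moreover have "wdeg w (coeff (pderiv \<Phi>) i * g ^ i) \<le> wdeg_at w g (pderiv \<Phi>)"
    using wdeg_at_le_iff by blast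
  then have "wdeg w (coeff (pderiv \<Phi>) i * g ^ i) + Fin \<delta> \<le> wdeg_at w g (pderiv \<Phi>) + Fin \<delta>"
    by (rule add_right_mono)
  then have "Fin \<gamma> \<le> wdeg_at w g (pderiv \<Phi>) + Fin \<delta>" unfolding shifted i .
  ultimately show ?thesis using \<gamma> by simp
qed

lemma wdeg_at_iterated_pderiv:
  fixes g :: "('n::{finite,linorder}, 'k::{idom,ring_char_0}) mpoly"
  assumes "\<Phi> \<noteq> 0" and g: "wdeg w g = Fin \<delta>" and "i \<le> m_mult w g \<Phi>"
  shows "(pderiv ^^ i) \<Phi> \<noteq> 0 \<and> wdeg_at w g ((pderiv ^^ i) \<Phi>) + Fin (nmult i \<delta>) = wdeg_at w g \<Phi>"
  using assms(3)
proof (induction i)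
  case 0
  show ?case using assms(1) by (cases "wdeg_at w g \<Phi>") auto
next
  case (Suc i)
  let ?\<Psi> = "(pderiv ^^ i) \<Phi>"
  have IH: "?\<Psi> \<noteq> 0" "wdeg_at w g ?\<Psi> + Fin (nmult i \<delta>) = wdeg_at w g \<Phi>" using Suc by auto
  have ne: "wdeg_at w g ?\<Psi> \<noteq> wdeg w (poly ?\<Psi> g)"
    using Suc.prems not_less_Least unfolding m_mult_def by (metis (mono_tags, lifting) Suc_le_lessD)
  have step: "wdeg_at w g (pderiv ?\<Psi>) + Fin \<delta> = wdeg_at w g ?\<Psi>"
    by (rule wdeg_at_pderiv[OF IH(1) g ne])
  have "g \<noteq> 0" using g by auto
  then obtain \<gamma> where \<gamma>: "wdeg_at w g ?\<Psi> = Fin \<gamma>" using wdeg_at_finite[OF IH(1)] by metis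
  have "pderiv ?\<Psi> \<noteq> 0"
  proof
    assume "pderiv ?\<Psi> = 0"
    then have "wdeg_at w g (pderiv ?\<Psi>) = Minf" by (simp add: wdeg_at_def)
    then show False using step \<gamma> by simp
  qed
  moreover have "wdeg_at w g (pderiv ?\<Psi>) + Fin (nmult (Suc i) \<delta>) = wdeg_at w g \<Phi>"
    unfolding IH(2)[symmetric] step[symmetric]
    by (simp add: nmult_Suc add.assoc) (simp add: add.commute)
  ultimately show ?case by simp
qed

text \<open>
  The minimum defining \<open>m_mult\<close> exists, as both degrees are \<open>-\<infinity>\<close> once \<open>\<Phi>\<close> has been
  differentiated to zero.
\<close>

lemma m_mult_attained:
  fixes g :: "('n::{finite,linorder}, 'k::{idom,ring_char_0}) mpoly"
  shows "wdeg_at w g ((pderiv ^^ m_mult w g \<Phi>) \<Phi>) = wdeg w (poly ((pderiv ^^ m_mult w g \<Phi>) \<Phi>) g)"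
  unfolding m_mult_def
proof (rule LeastI)
  have "degree ((pderiv ^^ i) \<Phi>) = degree \<Phi> - i" for i
    by (induction i) (auto simp: degree_pderiv)
  then have "(pderiv ^^ Suc (degree \<Phi>)) \<Phi> = 0" by (simp add: pderiv_eq_0_iff)
  then show "wdeg_at w g ((pderiv ^^ Suc (degree \<Phi>)) \<Phi>) = wdeg w (poly ((pderiv ^^ Suc (degree \<Phi>)) \<Phi>) g)"
    by (simp add: wdeg_at_def)
qed

lemma nmult_Fin: "nmult m (Fin a) = Fin (nmult m a)"
  by (induction m) (simp_all add: nmult_Suc zero_extended_def)

lemma nmult_plus: "nmult m (a + b) = nmult m a + nmult m b"
  by (simp add: nmult_def sum.distrib)

lemma nmult_diff: "nmult m (a - b) = nmult m a - nmult m (b :: 'g::ab_group_add)"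
  by (induction m) (simp_all add: nmult_Suc algebra_simps)

section \<open>The inequality\<close>

theorem theorem2p1:
  fixes f :: "nat \<Rightarrow> ('n::{finite,linorder}, 'k::field_char_0) mpoly"
    and r :: nat
    and \<Phi> :: "('n, 'k) mpoly poly"
    and g :: "('n, 'k) mpoly"
    and w :: "'n \<Rightarrow> 'g::linordered_ab_group_add"
    and \<omega> :: "('n, 'k) form"
  assumes "r \<ge> 1"
    and "alg_independent f r"
    and "\<omega> = wedge_differentials f r"
    and "\<forall>i. coeff \<Phi> i \<in> gen_subalgebra f r"
    and "\<Phi> \<noteq> 0"
    and "g \<noteq> 0"
  shows "wdeg w (poly \<Phi> g) \<ge>
           wdeg_at w g \<Phi> +
           nmult (m_mult w g \<Phi>)
             (form_wdeg w (\<omega> \<and>\<^sub>F differential g) - form_wdeg w \<omega> - wdeg w g)"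
proof -
  define m where "m = m_mult w g \<Phi>"
  let ?\<Phi> = "\<lambda>i. (pderiv ^^ i) \<Phi>"
  obtain \<delta> where \<delta>: "wdeg w g = Fin \<delta>" using \<open>g \<noteq> 0\<close> by (meson wdeg_eq_Max)
  obtain \<gamma> where \<gamma>: "wdeg_at w g \<Phi> = Fin \<gamma>" using wdeg_at_finite[OF assms(5,6)] .
  obtain I where "\<omega> I \<noteq> 0" using wedge_differentials_nonzero[OF assms(2)] assms(3) by blast
  then have "wdeg w (\<omega> I) + Fin (\<Sum>i\<in>I. w i) \<noteq> Minf" 
    by (cases "wdeg w (\<omega> I)") auto
  then have "form_wdeg w \<omega> \<noteq> Minf" using form_wdeg_ge[of w \<omega> I] by auto
  then obtain \<epsilon> where \<epsilon>: "form_wdeg w \<omega> = Fin \<epsilon>" by (cases "form_wdeg w \<omega>") auto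
  have top: "wdeg w (poly (?\<Phi> m) g) = Fin (\<gamma> - nmult m \<delta>)"
    using wdeg_at_iterated_pderiv[OF assms(5) \<delta>, of m] m_mult_attained[of w g \<Phi>] \<gamma>
    by (cases "wdeg w (poly (?\<Phi> m) g)") (auto simp: m_def algebra_simps)
  show ?thesis
  proof (cases "form_wdeg w (\<omega> \<and>\<^sub>F differential g)")
    case (Fin \<beta>)
    \<comment> \<open>The degree of \<open>\<omega> \<and> d(\<Phi>\<^sup>(\<^sup>i\<^sup>)(g))\<close>, estimated from both sides; \<open>deg \<omega>\<close> stays on the right
      since \<open>wdeg w (poly (?\<Phi> i) g)\<close> may be \<open>-\<infinity>\<close>.\<close>
    have step: "wdeg w (poly (pderiv (?\<Phi> i)) g) + Fin \<beta> \<le> Fin \<epsilon> + wdeg w (poly (?\<Phi> i) g)" for i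
    proof -
      have "\<omega> \<and>\<^sub>F differential (poly (?\<Phi> i) g) = (\<lambda>K. poly (pderiv (?\<Phi> i)) g * (\<omega> \<and>\<^sub>F differential g) K)"
        using assms(3,4) wedge_differential_gen_subalgebra
        by (intro wedge_differential_poly wedge_differential_coeff_pderiv) blast
      then show ?thesis
        using form_wdeg_scale_ge[of w "poly (pderiv (?\<Phi> i)) g" "\<omega> \<and>\<^sub>F differential g"]
          form_wdeg_wedge_differential_le[of w \<omega> "poly (?\<Phi> i) g"]
        by (simp add: Fin \<epsilon>)
    qed
    have "wdeg w (poly (?\<Phi> i) g) + Fin (nmult i (\<beta> - \<epsilon>)) \<le> wdeg w (poly \<Phi> g)" for i
    proof (induction i)
      case 0
      show ?case by (cases "wdeg w (poly \<Phi> g)") auto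
    next
      case (Suc i)
      have "wdeg w (poly (?\<Phi> (Suc i)) g) + Fin (\<beta> - \<epsilon>) \<le> wdeg w (poly (?\<Phi> i) g)"
        using step[of i] by (cases "wdeg w (poly (?\<Phi> i) g)"; cases "wdeg w (poly (?\<Phi> (Suc i)) g)")
          (auto simp: algebra_simps)
      then have "wdeg w (poly (?\<Phi> (Suc i)) g) + Fin (\<beta> - \<epsilon>) + Fin (nmult i (\<beta> - \<epsilon>)) \<le>
          wdeg w (poly (?\<Phi> i) g) + Fin (nmult i (\<beta> - \<epsilon>))" by (rule add_right_mono)
      then show ?case using Suc by (simp add: nmult_Suc add.assoc add.commute[of "\<beta> - \<epsilon>"])
    qed
    from this[of m] show ?thesis
      by (simp add: Fin \<epsilon> \<delta> \<gamma> top nmult_Fin nmult_diff nmult_plus algebra_simps flip: m_def)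
  next
    \<comment> \<open>If \<open>\<omega> \<and> dg = 0\<close>, the right-hand side is \<open>-\<infinity>\<close> unless \<open>m = 0\<close>, and then both sides agree.\<close>
    case Minf
    show ?thesis
    proof (cases m)
      case 0
      then show ?thesis using top \<gamma> by (simp add: zero_extended_def flip: m_def)
    next
      case (Suc k)
      have "nmult (Suc k) (Minf :: 'g extended) = Minf"
        by (induction k) (auto simp: nmult_Suc zero_extended_def)
      then show ?thesis using Suc by (simp add: Minf \<epsilon> \<delta> \<gamma> flip: m_def)
    qed
  qed auto
qed

end
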